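(* Let $\{(p^k,x^k,y^k)\}_{k\in\mathbb N}$ be the sequence generated by the PAPC algorithm (defined in the context), and let $\hat u=(\hat x,\hat y)$ be any saddle point of $K(\cdot,\cdot)$. Write $u^k=(x^k,y^k)$. If Assumptions 1 and 2 of the context are satisfied, then, for any $\alpha>1$ and for all $k\ge 1$, $$\|u^k-\hat u\|_H^2\le \frac{1}{1+\delta}\,\|u^{k-1}-\hat u\|_H^2,$$ where $$\delta=\min\left\{\frac{(\alpha-1)\tau\sigma(1-\tau L_f)\lambda_{\min}(\mathcal A^T\mathcal A)}{\alpha},\ \frac{\mu\tau\sigma\lambda_{\min}(\mathcal A^T\mathcal A)}{\alpha\tau L_f^2+\sigma\lambda_{\min}(\mathcal A^T\mathcal A)}\right\}$$ is positive and $\mu>0$ is the constant of pointwise quadratic supportability of $f$ at $\hat x$, depending on the distance of the initial guess to the point $(\hat x,\hat y)$; that is, $\mu>0$ is such that $$f(x^k)\ge f(\hat x)+\langle\nabla f(\hat x),x^k-\hat x\rangle+\tfrac{\mu}{2}\|x^k-\hat x\|^2\quad\text{for all }k.$$ In particular, $\{(x^k,y^k)\}_{k\in\mathbb N}$ is $Q$-linearly convergent with respect to the $H$-norm to a saddle point of $K$.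
   Context: Primal problem: minimize $p(x):=f(x)+\sum_{i=1}^p g_i(A_i^Tx)$ over $x\in\mathbb R^n$; $X^*$ denotes its set of optimal solutions. With $m=\sum_{i=1}^p m_i$ and $y=(y_1,\dots,y_p)\in\mathbb R^m$, $y_i\in\mathbb R^{m_i}$, set $g(y)=\sum_i g_i(y_i)$, $\mathcal A:\mathbb R^m\to\mathbb R^n$, $\mathcal Ay=\sum_i A_iy_i$, and $g^*(y)=\sum_i g_i^*(y_i)$ (Fenchel conjugates). The Lagrangian is $K(x,y):=f(x)+\langle x,\mathcal Ay\rangle-g^*(y)$. A saddle point of $K$ is a pair $(\hat x,\hat y)\in\mathbb R^n\times\mathbb R^m$ with $K(\hat x,y)\le K(\hat x,\hat y)\le K(x,\hat y)$ for all $x\in\mathbb R^n$, $y\in\mathbb R^m$. Here $\lambda_{\min}$ denotes the smallest eigenvalue of a symmetric matrix and $\sigma_{\min}$ the smallest nonzero singular value of a matrix. Assumption 1: (i) $f:\mathbb R^n\to\mathbb R$ is convex and continuously differentiable, with gradient Lipschitz continuous with constant $L_f$; (ii) each $g_i:\mathbb R^{m_i}\to(-\infty,+\infty]$, $i=1,\dots,p$, is proper, lower semicontinuous and convex; (iii) the linear mappings $A_i:\mathbb R^{m_i}\to\mathbb R^n$, $i=1,\dots,p$, are full rank, that is, $\sigma_{\min}^2(A_i)=\lambda_{\min}(A_i^TA_i)>0$; (iv) $X^*\neq\emptyset$. Assumption 2: $f$ is pointwise quadratically supportable at each $\hat x\in X^*$, i.e. for each $\hat x\in X^*$ there exist $\mu>0$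 and a convex neighborhood $V$ of $\hat x$ with $f(x)\ge f(\hat x)+\langle\nabla f(\hat x),x-\hat x\rangle+\frac{\mu}{2}\|x-\hat x\|^2$ for all $x\in V$. PAPC (Proximal Alternating Predictor-Corrector) algorithm: given $(x^0,y^0)\in\mathbb R^n\times\mathbb R^m$ and parameters $\tau\in(0,1/L_f)$, $0<\tau\sigma\le 1/\|\mathcal A^T\mathcal A\|$, for $k=1,2,\dots$: $p^k=x^{k-1}-\tau(\nabla f(x^{k-1})+\mathcal Ay^{k-1})$; $y_i^k=\arg\max_{y_i\in\mathbb R^{m_i}}\{\langle A_i^Tp^k,y_i\rangle-g_i^*(y_i)-\frac1{2\sigma}\|y_i-y_i^{k-1}\|^2\}$ for $i=1,\dots,p$; $x^k=x^{k-1}-\tau(\nabla f(x^{k-1})+\mathcal Ay^k)$. Norms: $\|z\|_M^2:=\langle z,Mz\rangle$ for symmetric positive semidefinite $M$ (in general a semi-norm); $G:=\sigma^{-1}I_m-\tau\mathcal A^T\mathcal A\succeq0$; for $u=(x,y)$, $\|u\|_H^2:=\frac1\tau\|x\|^2+\|y\|_G^2$, i.e. $H=\begin{pmatrix}\tau^{-1}I_n&0\\0&G\end{pmatrix}$. A sequence $z^k$ converging to $z^*$ converges $Q$-linearly (with respect to a given (semi-)norm) if there is $c\in(0,1)$ with $\|z^{k+1}-z^*\|\le c\|z^k-z^*\|$ for all $k$.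
   Formalization: Positivity of δ and Q-linear convergence are stated only when λ_min(𝒜ᵀ𝒜)>0; full rank of each A_i does not imply this for p≥2 (A_1=A_2=1 gives δ=0, and linear convergence can fail). The contraction inequality and the existence of μ are stated without it. *)

theory Defs
  imports "HOL-Analysis.Analysis"
begin

text \<open>
  The number of blocks and their dimensions are arbitrary, so the block spaces cannot be types of
  their own. The full space is \<open>real^'m\<close>, and a surjection \<open>blk :: 'm \<Rightarrow> 'p\<close> assigns each
  coordinate to a block: block \<open>i\<close> has dimension \<open>card {j. blk j = i} \<ge> 1\<close> and is identified with
  the coordinate subspace \<open>blk_space blk i\<close>. A linear map from block \<open>i\<close> to \<open>real^'n\<close> is a
  matrix whose columns outside block \<open>i\<close> vanish; then its transpose maps into
  \<open>blk_space blk i\<close>, and the horizontal concatenation of the block matrices is their sum.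
  Functions on block \<open>i\<close> are functions on \<open>real^'m\<close> of which only the values on
  \<open>blk_space blk i\<close> are used.
\<close>

definition blk_space :: "('m::finite \<Rightarrow> 'p) \<Rightarrow> 'p \<Rightarrow> (real^'m) set" where
  "blk_space blk i = {y. \<forall>j. blk j \<noteq> i \<longrightarrow> y $ j = 0}"

definition blk_part :: "('m::finite \<Rightarrow> 'p) \<Rightarrow> 'p \<Rightarrow> real^'m \<Rightarrow> real^'m" where
  "blk_part blk i y = (\<chi> j. if blk j = i then y $ j else 0)"

definition blk_matrix :: "('m::finite \<Rightarrow> 'p) \<Rightarrow> 'p \<Rightarrow> real^'m^'n::finite \<Rightarrow> bool" where
  "blk_matrix blk i B \<longleftrightarrow> (\<forall>r j. blk j \<noteq> i \<longrightarrow> B $ r $ j = 0)"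

definition calA :: "('p::finite \<Rightarrow> real^'m::finite^'n::finite) \<Rightarrow> real^'m^'n" where
  "calA A = (\<Sum>i\<in>UNIV. A i)"


definition proper_on :: "'a set \<Rightarrow> ('a \<Rightarrow> ereal) \<Rightarrow> bool" where
  "proper_on S h \<longleftrightarrow> (\<forall>v\<in>S. h v \<noteq> - \<infinity>) \<and> (\<exists>v\<in>S. h v \<noteq> \<infinity>)"

definition lsc_on :: "'a::topological_space set \<Rightarrow> ('a \<Rightarrow> ereal) \<Rightarrow> bool" where
  "lsc_on S h \<longleftrightarrow> (\<forall>v\<in>S. h v \<le> Liminf (at v within S) h)"

definition ereal_convex_on :: "'a::real_vector set \<Rightarrow> ('a \<Rightarrow> ereal) \<Rightarrow> bool" where
  "ereal_convex_on S h \<longleftrightarrow> convex {(v, t::real). v \<in> S \<and> h v \<le> ereal t}"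

definition fenchel_conj :: "'a::real_inner set \<Rightarrow> ('a \<Rightarrow> ereal) \<Rightarrow> 'a \<Rightarrow> ereal" where
  "fenchel_conj S h v = (SUP w\<in>S. ereal (v \<bullet> w) - h w)"


text \<open>
  Smallest eigenvalue of a symmetric matrix viewed as an operator on an invariant subspace.
  The subspace is needed for \<open>transpose (A i) ** A i\<close>, which acts on \<open>blk_space blk i\<close> and is
  zero on the other coordinates.
\<close>

definition lambda_min_on :: "(real^'m) set \<Rightarrow> real^'m::finite^'m \<Rightarrow> real" where
  "lambda_min_on S M = Min {l. \<exists>v\<in>S. v \<noteq> 0 \<and> M *v v = l *\<^sub>R v}"

abbreviation lambda_min :: "real^'m::finite^'m \<Rightarrow> real" where
  "lambda_min \<equiv> lambda_min_on UNIV"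

definition primal ::
  "(real^'n::finite \<Rightarrow> real) \<Rightarrow> ('p::finite \<Rightarrow> real^'m::finite \<Rightarrow> ereal) \<Rightarrow>
    ('p \<Rightarrow> real^'m^'n) \<Rightarrow> real^'n \<Rightarrow> ereal" where
  "primal f g A x = ereal (f x) + (\<Sum>i\<in>UNIV. g i (transpose (A i) *v x))"

text \<open>A point is optimal only if it is feasible, that is, if its value is finite.\<close>

definition primal_solutions ::
  "(real^'n::finite \<Rightarrow> real) \<Rightarrow> ('p::finite \<Rightarrow> real^'m::finite \<Rightarrow> ereal) \<Rightarrow>
    ('p \<Rightarrow> real^'m^'n) \<Rightarrow> (real^'n) set" where
  "primal_solutions f g A =
    {x. primal f g A x < \<infinity> \<and> (\<forall>z. primal f g A x \<le> primal f g A z)}"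

definition lagrangian ::
  "(real^'n::finite \<Rightarrow> real) \<Rightarrow> ('m::finite \<Rightarrow> 'p::finite) \<Rightarrow> ('p \<Rightarrow> real^'m \<Rightarrow> ereal) \<Rightarrow>
    ('p \<Rightarrow> real^'m^'n) \<Rightarrow> real^'n \<Rightarrow> real^'m \<Rightarrow> ereal" where
  "lagrangian f blk g A x y =
    ereal (f x + x \<bullet> (calA A *v y))
      - (\<Sum>i\<in>UNIV. fenchel_conj (blk_space blk i) (g i) (blk_part blk i y))"

definition saddle_point :: "('a \<Rightarrow> 'b \<Rightarrow> ereal) \<Rightarrow> 'a \<times> 'b \<Rightarrow> bool" where
  "saddle_point K u \<longleftrightarrow>
    (\<forall>x y. K (fst u) y \<le> K (fst u) (snd u) \<and> K (fst u) (snd u) \<le> K x (snd u))"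

definition quad_support_at ::
  "('a::real_inner \<Rightarrow> real) \<Rightarrow> ('a \<Rightarrow> 'a) \<Rightarrow> real \<Rightarrow> 'a \<Rightarrow> 'a \<Rightarrow> bool" where
  "quad_support_at f gradf \<mu> xh x \<longleftrightarrow>
    f x \<ge> f xh + gradf xh \<bullet> (x - xh) + \<mu> / 2 * (norm (x - xh))\<^sup>2"

definition pointwise_quad_supportable ::
  "('a::real_inner \<Rightarrow> real) \<Rightarrow> ('a \<Rightarrow> 'a) \<Rightarrow> 'a \<Rightarrow> bool" where
  "pointwise_quad_supportable f gradf xh \<longleftrightarrow>
    (\<exists>\<mu>>0. \<exists>V. convex V \<and> xh \<in> interior V \<and> (\<forall>x\<in>V. quad_support_at f gradf \<mu> xh x))"

definition papc ::
  "(real^'n::finite \<Rightarrow> real^'n) \<Rightarrow> ('m::finite \<Rightarrow> 'p::finite) \<Rightarrow> ('p \<Rightarrow> real^'m \<Rightarrow> ereal) \<Rightarrow>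
    ('p \<Rightarrow> real^'m^'n) \<Rightarrow> real \<Rightarrow> real \<Rightarrow>
    (nat \<Rightarrow> real^'n) \<Rightarrow> (nat \<Rightarrow> real^'n) \<Rightarrow> (nat \<Rightarrow> real^'m) \<Rightarrow> bool" where
  "papc gradf blk g A \<tau> \<sigma> p x y \<longleftrightarrow>
    (\<forall>k\<ge>1.
      p k = x (k - 1) - \<tau> *\<^sub>R (gradf (x (k - 1)) + calA A *v y (k - 1)) \<and>
      (\<forall>i. is_arg_max
             (\<lambda>v. ereal ((transpose (A i) *v p k) \<bullet> v)
                   - fenchel_conj (blk_space blk i) (g i) v
                   - ereal (1 / (2 * \<sigma>) * (norm (v - blk_part blk i (y (k - 1))))\<^sup>2))
             (\<lambda>v. v \<in> blk_space blk i)
             (blk_part blk i (y k))) \<and>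
      x k = x (k - 1) - \<tau> *\<^sub>R (gradf (x (k - 1)) + calA A *v y k))"

definition G_matrix :: "real \<Rightarrow> real \<Rightarrow> real^'m::finite^'n::finite \<Rightarrow> real^'m^'m" where
  "G_matrix \<tau> \<sigma> B = mat (1 / \<sigma>) - \<tau> *\<^sub>R (transpose B ** B)"

definition sqnorm_H ::
  "real \<Rightarrow> real \<Rightarrow> real^'m::finite^'n::finite \<Rightarrow> (real^'n) \<times> (real^'m) \<Rightarrow> real" where
  "sqnorm_H \<tau> \<sigma> B u =
    1 / \<tau> * (norm (fst u))\<^sup>2 + snd u \<bullet> (G_matrix \<tau> \<sigma> B *v snd u)"

definition norm_H ::
  "real \<Rightarrow> real \<Rightarrow> real^'m::finite^'n::finite \<Rightarrow> (real^'n) \<times> (real^'m) \<Rightarrow> real" where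
  "norm_H \<tau> \<sigma> B u = sqrt (sqnorm_H \<tau> \<sigma> B u)"

definition Q_linear ::
  "('a::{topological_space, minus} \<Rightarrow> real) \<Rightarrow> (nat \<Rightarrow> 'a) \<Rightarrow> 'a \<Rightarrow> bool" where
  "Q_linear N z zs \<longleftrightarrow>
    z \<longlonglongrightarrow> zs \<and>
    (\<exists>c. 0 < c \<and> c < 1 \<and> (\<forall>k. N (z (Suc k) - zs) \<le> c * N (z k - zs)))"

definition papc_delta :: "real \<Rightarrow> real \<Rightarrow> real \<Rightarrow> real \<Rightarrow> real \<Rightarrow> real \<Rightarrow> real" where
  "papc_delta \<tau> \<sigma> L lam \<mu> \<alpha> =
    min ((\<alpha> - 1) * \<tau> * \<sigma> * (1 - \<tau> * L) * lam / \<alpha>)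
        (\<mu> * \<tau> * \<sigma> * lam / (\<alpha> * \<tau> * L\<^sup>2 + \<sigma> * lam))"

text \<open>
  Full column rank of every block \<open>A i\<close> does not imply full column rank of \<open>calA A\<close> when there are
  several blocks (take two equal \<open>1 \<times> 1\<close> blocks), and without the latter the rate \<open>papc_delta\<close> is
  \<open>0\<close> and linear convergence can fail. The contraction inequality itself needs only the former.
\<close>

definition coupling_full_rank :: "('p::finite \<Rightarrow> real^'m::finite^'n::finite) \<Rightarrow> bool" where
  "coupling_full_rank A \<longleftrightarrow> lambda_min (transpose (calA A) ** calA A) > 0"

end

theory Submission
  imports Defs
begin

text \<open>
  Measure the error of an iterate \<open>(x, y)\<close> against the saddle point \<open>(xh, yh)\<close> in the squared \<open>H\<close>-norm.
  The dual step is a proximal step on the conjugates and the corrected primal step is a gradient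
  step; adding the monotonicity inequality of the conjugates (\<open>papc_dual_monotone\<close>) to the gradient
  inequalities of \<open>f\<close> makes the bilinear coupling terms cancel. Hence each iteration lowers the
  squared error by at least \<open>(1 / \<tau> - L) * (norm (x - x'))\<^sup>2 + \<mu> * (norm (x' - xh))\<^sup>2\<close>, where \<open>x'\<close> is
  the new primal point and \<open>\<mu>\<close> is a constant of quadratic support at \<open>xh\<close> (\<open>papc_step_descent\<close>).

  To turn this gain into a contraction it must control the new dual error too. The primal update
  and the optimality condition \<open>gradf xh + calA A *v yh = 0\<close> write the image of the dual error under
  the coupling matrix through \<open>x - x'\<close> and \<open>x' - xh\<close> (\<open>papc_dual_error_bound\<close>); Young's inequality
  with parameter \<open>\<alpha>\<close> separates the two, and the smallest eigenvalue of the Gram matrix passes from the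
  image to the error itself. Balancing coefficients gives exactly \<open>papc_delta\<close>
  (\<open>papc_step_contraction\<close>).

  A support constant for all iterates exists because the descent inequality with \<open>\<mu> = 0\<close>, where
  convexity provides the support, already confines them to a ball around \<open>xh\<close> whose radius depends on the
  initial error, and local quadratic support of a convex function extends to any ball
  (\<open>quad_support_on_balls\<close>). Local support is assumed only at primal solutions, so \<open>xh\<close> has to be one;
  this is the place where the \<open>g i\<close> must be closed and convex, through the Fenchel-Moreau theorem
  (\<open>affine_minorant_above\<close>, \<open>saddle_point_imp_primal_solution\<close>). Finally, the \<open>H\<close>-norm controls
  the primal error, and under full rank of the coupling matrix the dual iterates converge because
  their images do.
\<close>

section \<open>Convex functions with Lipschitz gradient\<close>

lemma gderiv_along_line:
  fixes f :: "'a::real_inner \<Rightarrow> real"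
  assumes "GDERIV f (a + t *\<^sub>R d) :> D"
  shows "((\<lambda>s. f (a + s *\<^sub>R d)) has_real_derivative D \<bullet> d) (at t)"
proof -
  have "((\<lambda>s. a + s *\<^sub>R d) has_derivative (\<lambda>s. s *\<^sub>R d)) (at t)"
    by (auto intro!: derivative_eq_intros)
  moreover have "(f has_derivative (\<lambda>h. h \<bullet> D)) (at (a + t *\<^sub>R d))"
    using assms by (simp add: gderiv_def)
  ultimately have "((\<lambda>s. f (a + s *\<^sub>R d)) has_derivative (\<lambda>s. (s *\<^sub>R d) \<bullet> D)) (at t)"
    by (rule has_derivative_compose)
  then show ?thesis
    by (simp add: has_field_derivative_def inner_commute mult.commute[of _ "D \<bullet> d"])
qed

lemma convex_above_tangent:
  fixes f :: "'a::real_inner \<Rightarrow> real"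
  assumes conv: "convex_on UNIV f" and deriv: "GDERIV f a :> D"
  shows "f a + D \<bullet> (b - a) \<le> f b"
proof -
  let ?\<phi> = "\<lambda>s::real. f (a + s *\<^sub>R (b - a))"
  have "convex_on UNIV ?\<phi>"
  proof (rule convex_onI)
    fix t x y :: real
    assume "0 < t" "t < 1"
    have "a + ((1 - t) *\<^sub>R x + t *\<^sub>R y) *\<^sub>R (b - a)
        = (1 - t) *\<^sub>R (a + x *\<^sub>R (b - a)) + t *\<^sub>R (a + y *\<^sub>R (b - a))"
      by (simp add: algebra_simps)
    with \<open>0 < t\<close> \<open>t < 1\<close> show "?\<phi> ((1 - t) *\<^sub>R x + t *\<^sub>R y) \<le> (1 - t) * ?\<phi> x + t * ?\<phi> y"
      using convex_onD[OF conv, of t] by simp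
  qed simp
  moreover have "(?\<phi> has_real_derivative D \<bullet> (b - a)) (at 0)"
    by (rule gderiv_along_line) (use deriv in simp)
  ultimately have "?\<phi> 1 - ?\<phi> 0 \<ge> (D \<bullet> (b - a)) * (1 - 0)"
    by (intro convex_on_imp_above_tangent[where A = UNIV]) auto
  then show ?thesis by simp
qed

text \<open>
  Along the segment from \<open>a\<close> to \<open>b\<close> the derivative of \<open>f\<close> minus its quadratic majorant is
  nonpositive, because the gradient moves by at most \<open>L\<close> times the distance travelled.
\<close>

lemma descent_lemma:
  fixes f :: "'a::real_inner \<Rightarrow> real"
  assumes deriv: "\<And>x. GDERIV f x :> gradf x" and lip: "L-lipschitz_on UNIV gradf"
  shows "f b \<le> f a + gradf a \<bullet> (b - a) + L / 2 * (norm (b - a))\<^sup>2"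
proof -
  define d where "d = b - a"
  let ?\<psi> = "\<lambda>s. f (a + s *\<^sub>R d) - s * (gradf a \<bullet> d) - L / 2 * s\<^sup>2 * (norm d)\<^sup>2"
  have "?\<psi> 1 \<le> ?\<psi> 0"
  proof (rule DERIV_nonpos_imp_nonincreasing[where f = ?\<psi>])
    fix s :: real
    assume s: "0 \<le> s" "s \<le> 1"
    let ?D = "gradf (a + s *\<^sub>R d) \<bullet> d - gradf a \<bullet> d - L * s * (norm d)\<^sup>2"
    have "((\<lambda>s. f (a + s *\<^sub>R d)) has_real_derivative gradf (a + s *\<^sub>R d) \<bullet> d) (at s)"
      by (rule gderiv_along_line[OF deriv])
    then have "(?\<psi> has_real_derivative ?D) (at s)"
      by (auto intro!: derivative_eq_intros)
    moreover have "?D \<le> 0"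
    proof -
      have "(gradf (a + s *\<^sub>R d) - gradf a) \<bullet> d \<le> norm (gradf (a + s *\<^sub>R d) - gradf a) * norm d"
        by (rule norm_cauchy_schwarz)
      also have "\<dots> \<le> (L * (s * norm d)) * norm d"
        using lipschitz_onD[OF lip, of "a + s *\<^sub>R d" a] s
        by (intro mult_right_mono) (simp_all add: dist_norm)
      finally show ?thesis by (simp add: inner_diff_left power2_eq_square mult.assoc)
    qed
    ultimately show "\<exists>D. (?\<psi> has_real_derivative D) (at s) \<and> D \<le> 0" by blast
  qed simp
  then show ?thesis by (simp add: d_def)
qed

text \<open>
  The Baillon-Haddad inequality. A gradient step of length \<open>1 / L\<close> from \<open>b\<close> on \<open>f\<close> minus its
  tangent at \<open>a\<close>, a convex function minimal at \<open>a\<close>, decreases the value by at least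
  \<open>(norm h)\<^sup>2 / (2 * L)\<close>; this is the claim \<open>half\<close>, and adding it to its mirror image gives the
  result.
\<close>

lemma gradient_cocoercive:
  fixes f :: "'a::real_inner \<Rightarrow> real"
  assumes conv: "convex_on UNIV f" and deriv: "\<And>x. GDERIV f x :> gradf x"
    and lip: "L-lipschitz_on UNIV gradf" and "L > 0"
  shows "(norm (gradf x - gradf y))\<^sup>2 \<le> L * ((gradf x - gradf y) \<bullet> (x - y))"
proof -
  have half: "f a + gradf a \<bullet> (b - a) + (norm (gradf b - gradf a))\<^sup>2 / (2 * L) \<le> f b" for a b
  proof -
    define h where "h = gradf b - gradf a"
    let ?w = "b - (1 / L) *\<^sub>R h"
    have "f a + gradf a \<bullet> (?w - a) \<le> f ?w"
      by (rule convex_above_tangent[OF conv deriv])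
    also have "\<dots> \<le> f b + gradf b \<bullet> (?w - b) + L / 2 * (norm (?w - b))\<^sup>2"
      by (rule descent_lemma[OF deriv lip])
    also have "L / 2 * (norm (?w - b))\<^sup>2 = (norm h)\<^sup>2 / (2 * L)"
      using \<open>L > 0\<close> by (simp add: power_mult_distrib power_divide power2_eq_square field_simps)
    finally have "f a + gradf a \<bullet> (b - a) + (gradf b - gradf a) \<bullet> h / L \<le> f b + (norm h)\<^sup>2 / (2 * L)"
      by (simp add: inner_diff_left inner_diff_right diff_divide_distrib)
    then have "f a + gradf a \<bullet> (b - a) + (norm h)\<^sup>2 / L \<le> f b + (norm h)\<^sup>2 / (2 * L)"
      by (simp add: h_def power2_norm_eq_inner)
    moreover have "(norm h)\<^sup>2 / L = (norm h)\<^sup>2 / (2 * L) + (norm h)\<^sup>2 / (2 * L)"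
      using \<open>L > 0\<close> by (simp add: field_simps)
    ultimately show ?thesis by (simp add: h_def)
  qed
  have "(norm (gradf x - gradf y))\<^sup>2 / L \<le> (gradf x - gradf y) \<bullet> (x - y)"
    using half[of x y] half[of y x] \<open>L > 0\<close>
    by (simp add: norm_minus_commute[of "gradf y" "gradf x"] inner_diff_left inner_diff_right field_simps)
  then show ?thesis using \<open>L > 0\<close> by (simp add: field_simps)
qed

text \<open>
  Expanding the square, the cross term dominates the quadratic term by cocoercivity. The estimate is
  sharper than what the Lipschitz bound on the gradient yields, and it is what makes the first
  term of the rate free of a further factor depending on \<open>\<tau> * L\<close>.
\<close>

lemma gradient_step_nonexpansive:
  fixes f :: "'a::real_inner \<Rightarrow> real"
  assumes conv: "convex_on UNIV f" and deriv: "\<And>x. GDERIV f x :> gradf x"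
    and lip: "L-lipschitz_on UNIV gradf" and "L > 0" and "0 \<le> \<tau>" "\<tau> * L \<le> 2"
  shows "norm ((x - \<tau> *\<^sub>R gradf x) - (y - \<tau> *\<^sub>R gradf y)) \<le> norm (x - y)"
proof -
  define d h where "d = x - y" and "h = gradf x - gradf y"
  have coco: "(norm h)\<^sup>2 \<le> L * (h \<bullet> d)"
    unfolding d_def h_def by (rule gradient_cocoercive[OF conv deriv lip \<open>L > 0\<close>])
  then have "0 \<le> L * (h \<bullet> d)" by (rule order_trans[OF zero_le_power2])
  then have pos: "0 \<le> h \<bullet> d" using \<open>L > 0\<close> by (simp add: zero_le_mult_iff)
  have "\<tau> * (norm h)\<^sup>2 \<le> (\<tau> * L) * (h \<bullet> d)"
    using mult_left_mono[OF coco \<open>0 \<le> \<tau>\<close>] by (simp add: mult.assoc)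
  also have "\<dots> \<le> 2 * (h \<bullet> d)"
    using \<open>\<tau> * L \<le> 2\<close> pos by (rule mult_right_mono)
  finally have "\<tau> * (\<tau> * (norm h)\<^sup>2) \<le> \<tau> * (2 * (h \<bullet> d))"
    using \<open>0 \<le> \<tau>\<close> by (rule mult_left_mono)
  moreover have "(norm (d - \<tau> *\<^sub>R h))\<^sup>2 = (norm d)\<^sup>2 - \<tau> * (2 * (h \<bullet> d)) + \<tau> * (\<tau> * (norm h)\<^sup>2)"
    by (simp add: power2_norm_eq_inner inner_diff_left inner_diff_right inner_commute algebra_simps)
  ultimately have "(norm (d - \<tau> *\<^sub>R h))\<^sup>2 \<le> (norm d)\<^sup>2" by simp
  then have "norm (d - \<tau> *\<^sub>R h) \<le> norm d" by (simp add: abs_le_square_iff[symmetric])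
  then show ?thesis by (simp add: d_def h_def algebra_simps)
qed

text \<open>
  Local quadratic support of a convex function propagates to every ball at the price of a
  smaller constant: outside the neighbourhood the Bregman distance to \<open>xh\<close> grows at least linearly
  along rays, and on a bounded set linear growth dominates a small multiple of quadratic growth.
\<close>

lemma quad_support_on_balls:
  fixes f :: "'a::real_inner \<Rightarrow> real"
  assumes conv: "convex_on UNIV f"
    and supp: "pointwise_quad_supportable f gradf xh"
  obtains M where "\<And>r. (M r :: real) > 0"
    and "\<And>r x. norm (x - xh) \<le> r \<Longrightarrow> quad_support_at f gradf (M r) xh x"
proof -
  obtain \<mu> V where "\<mu> > 0" "xh \<in> interior V" and V: "\<And>x. x \<in> V \<Longrightarrow> quad_support_at f gradf \<mu> xh x"
    using supp unfolding pointwise_quad_supportable_def by blast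
  then obtain \<epsilon> where "\<epsilon> > 0" and ball: "cball xh \<epsilon> \<subseteq> V"
    by (meson mem_interior_cball)
  have near: "gradf xh \<bullet> v + \<mu> / 2 * (norm v)\<^sup>2 \<le> f (xh + v) - f xh" if "norm v \<le> \<epsilon>" for v
    using V[of "xh + v"] ball that by (auto simp: quad_support_at_def dist_norm subset_iff)
  define M where "M r = \<mu> * \<epsilon> / (\<epsilon> + \<bar>r\<bar>)" for r
  have M_pos: "M r > 0" for r
    using \<open>\<mu> > 0\<close> \<open>\<epsilon> > 0\<close> by (simp add: M_def add_pos_nonneg)
  have M_le: "M r \<le> \<mu>" for r
    using \<open>\<mu> > 0\<close> \<open>\<epsilon> > 0\<close> by (simp add: M_def field_simps)
  have "quad_support_at f gradf (M r) xh x" if r: "norm (x - xh) \<le> r" for r x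
  proof -
    define v where "v = x - xh"
    have x: "x = xh + v" by (simp add: v_def)
    have "gradf xh \<bullet> v + M r / 2 * (norm v)\<^sup>2 \<le> f (xh + v) - f xh"
    proof (cases "norm v \<le> \<epsilon>")
      case True
      have "M r / 2 * (norm v)\<^sup>2 \<le> \<mu> / 2 * (norm v)\<^sup>2"
        by (intro mult_right_mono) (use M_le[of r] in auto)
      with near[OF True] show ?thesis by linarith
    next
      case False
      define s where "s = norm v"
      \<comment> \<open>The ray from \<open>xh\<close> to \<open>x\<close> leaves the ball of radius \<open>\<epsilon>\<close> at parameter \<open>t\<close>.\<close>
      define t where "t = \<epsilon> / s"
      have s: "s > \<epsilon>" "s \<le> r" using False r by (simp_all add: s_def v_def)
      have t: "0 < t" "t < 1" using s \<open>\<epsilon> > 0\<close> by (auto simp: t_def)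
      have nt: "norm (t *\<^sub>R v) = \<epsilon>"
        using s \<open>\<epsilon> > 0\<close> by (simp add: t_def s_def[symmetric])
      have "xh + t *\<^sub>R v = (1 - t) *\<^sub>R xh + t *\<^sub>R (xh + v)"
        by (simp add: algebra_simps)
      then have "f (xh + t *\<^sub>R v) \<le> (1 - t) * f xh + t * f (xh + v)"
        using convex_onD[OF conv, of t xh "xh + v"] t by simp
      moreover have "t * (gradf xh \<bullet> v) + \<mu> / 2 * \<epsilon>\<^sup>2 \<le> f (xh + t *\<^sub>R v) - f xh"
        using near[of "t *\<^sub>R v"] unfolding nt by simp
      ultimately have "t * (gradf xh \<bullet> v) + \<mu> / 2 * \<epsilon>\<^sup>2 \<le> t * (f (xh + v) - f xh)"
        by (simp add: algebra_simps)
      moreover have "\<mu> / 2 * \<epsilon>\<^sup>2 = t * (\<mu> * \<epsilon> / 2 * s)"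
        using s \<open>\<epsilon> > 0\<close> by (simp add: t_def power2_eq_square)
      ultimately have "t * (gradf xh \<bullet> v + \<mu> * \<epsilon> / 2 * s) \<le> t * (f (xh + v) - f xh)"
        by (simp only: distrib_left)
      then have "gradf xh \<bullet> v + \<mu> * \<epsilon> / 2 * s \<le> f (xh + v) - f xh"
        using t by simp
      moreover have "M r * s \<le> \<mu> * \<epsilon>"
      proof -
        have "s / (\<epsilon> + \<bar>r\<bar>) \<le> 1" using s \<open>\<epsilon> > 0\<close> by (simp add: field_simps)
        then have "\<mu> * \<epsilon> * (s / (\<epsilon> + \<bar>r\<bar>)) \<le> \<mu> * \<epsilon> * 1"
          using \<open>\<mu> > 0\<close> \<open>\<epsilon> > 0\<close> by (intro mult_left_mono) auto
        then show ?thesis by (simp add: M_def)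
      qed
      then have "M r * s / 2 * s \<le> \<mu> * \<epsilon> / 2 * s"
        using s \<open>\<epsilon> > 0\<close> by (intro mult_right_mono) auto
      then have "M r / 2 * (norm v)\<^sup>2 \<le> \<mu> * \<epsilon> / 2 * s"
        by (simp add: s_def power2_eq_square)
      ultimately show ?thesis by linarith
    qed
    then show ?thesis by (simp add: quad_support_at_def x)
  qed
  with M_pos show thesis by (rule that)
qed

section \<open>Fenchel conjugates on a closed set\<close>

lemma fenchel_young:
  "w \<in> S \<Longrightarrow> ereal (v \<bullet> w) - h w \<le> fenchel_conj S h v"
  unfolding fenchel_conj_def by (rule SUP_upper)

lemma fenchel_conj_leI:
  assumes "\<And>w. w \<in> S \<Longrightarrow> ereal (v \<bullet> w - \<beta>) \<le> h w"
  shows "fenchel_conj S h v \<le> ereal \<beta>"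
  unfolding fenchel_conj_def
proof (rule SUP_least)
  fix w assume "w \<in> S"
  from assms[OF this] show "ereal (v \<bullet> w) - h w \<le> ereal \<beta>"
    by (cases "h w") auto
qed

lemma fenchel_conj_not_MInfty:
  assumes "proper_on S h"
  shows "fenchel_conj S h v \<noteq> - \<infinity>"
proof -
  obtain w where w: "w \<in> S" "h w \<noteq> \<infinity>" "h w \<noteq> - \<infinity>"
    using assms by (auto simp: proper_on_def)
  with fenchel_young[OF w(1), of v h] show ?thesis by (cases "h w") auto
qed

lemma fenchel_conj_convex:
  assumes "proper_on S h"
    and v: "fenchel_conj S h v = ereal a" and w: "fenchel_conj S h w = ereal b"
    and t: "0 \<le> t" "t \<le> 1"
  shows "fenchel_conj S h ((1 - t) *\<^sub>R v + t *\<^sub>R w) \<le> ereal ((1 - t) * a + t * b)"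
proof (rule fenchel_conj_leI)
  fix z assume "z \<in> S"
  show "ereal (((1 - t) *\<^sub>R v + t *\<^sub>R w) \<bullet> z - ((1 - t) * a + t * b)) \<le> h z"
  proof (cases "h z")
    case (real r)
    have "v \<bullet> z - r \<le> a" "w \<bullet> z - r \<le> b"
      using fenchel_young[OF \<open>z \<in> S\<close>, of v h] fenchel_young[OF \<open>z \<in> S\<close>, of w h] v w real by auto
    then have "(1 - t) * (v \<bullet> z - r) + t * (w \<bullet> z - r) \<le> (1 - t) * a + t * b"
      using t by (intro add_mono mult_left_mono) auto
    then show ?thesis using real by (simp add: inner_add_left algebra_simps)
  qed (use assms(1) \<open>z \<in> S\<close> in \<open>auto simp: proper_on_def\<close>)
qed

text \<open>
  Sequentially: were \<open>h v\<close> above the limit height \<open>t\<close>, lower semicontinuity would keep \<open>h\<close>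
  above some \<open>c > t\<close> near \<open>v\<close> and so strictly above the heights converging to \<open>t\<close>.
\<close>

lemma closed_epigraph:
  fixes h :: "'a::euclidean_space \<Rightarrow> ereal"
  assumes "closed S" and lsc: "lsc_on S h"
  shows "closed {(v, t::real). v \<in> S \<and> h v \<le> ereal t}"
  unfolding closed_sequential_limits
proof (intro allI impI)
  fix X and l :: "'a \<times> real"
  assume X: "(\<forall>n. X n \<in> {(v, t). v \<in> S \<and> h v \<le> ereal t}) \<and> X \<longlonglongrightarrow> l"
  obtain v t where l: "l = (v, t)" by (cases l)
  have lim: "(\<lambda>n. fst (X n)) \<longlonglongrightarrow> v" "(\<lambda>n. snd (X n)) \<longlonglongrightarrow> t"
    using X tendsto_fst[of X l sequentially] tendsto_snd[of X l sequentially] l by auto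
  have mem: "fst (X n) \<in> S" "h (fst (X n)) \<le> ereal (snd (X n))" for n
    using X by (auto simp: split_beta)
  have v: "v \<in> S"
    using closed_sequentially[OF \<open>closed S\<close>, of "\<lambda>n. fst (X n)" v] mem(1) lim(1) by blast
  have "h v \<le> ereal t"
  proof (rule ccontr)
    assume "\<not> h v \<le> ereal t"
    then obtain c where c: "ereal t < ereal c" "ereal c < h v"
      using ereal_dense2[of "ereal t" "h v"] by (auto simp: not_le)
    have "h v \<le> Liminf (at v within S) h" using lsc v by (simp add: lsc_on_def)
    with c have "\<forall>\<^sub>F w in at v within S. ereal c < h w"
      by (intro less_LiminfD) (rule less_le_trans)
    then have "\<forall>\<^sub>F w in nhds v. w \<in> S \<longrightarrow> ereal c < h w"
      unfolding eventually_at_filter by eventually_elim (use c in auto)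
    then have "\<forall>\<^sub>F n in sequentially. fst (X n) \<in> S \<longrightarrow> ereal c < h (fst (X n))"
      by (rule eventually_compose_filterlim[OF _ lim(1)])
    moreover have "\<forall>\<^sub>F n in sequentially. snd (X n) < c"
      using order_tendstoD(2)[OF lim(2)] c by simp
    ultimately have "\<forall>\<^sub>F n in sequentially. False"
    proof eventually_elim
      case (elim n)
      then have "ereal c < ereal (snd (X n))"
        using mem[of n] less_le_trans[of "ereal c" "h (fst (X n))" "ereal (snd (X n))"] by blast
      with elim show ?case by simp
    qed
    then show False by simp
  qed
  with v show "l \<in> {(v, t). v \<in> S \<and> h v \<le> ereal t}" by (simp add: l)
qed

text \<open>
  The core of the Fenchel-Moreau theorem. The point \<open>(x, c)\<close> lies below the closed convex epigraph,
  so a hyperplane separates it. If the hyperplane is not vertical it is the graph of the desired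
  minorant. A vertical one can only occur when \<open>x\<close> lies outside the domain of \<open>h\<close>; then it separates
  \<open>x\<close> from the domain, and adding a large multiple of it to a minorant obtained at a point of the
  domain lifts the value at \<open>x\<close> above \<open>c\<close>.
\<close>

lemma affine_minorant_above:
  fixes h :: "'a::euclidean_space \<Rightarrow> ereal"
  assumes "closed S" and proper: "proper_on S h" and lsc: "lsc_on S h"
    and conv: "ereal_convex_on S h" and "x \<in> S" and c: "ereal c < h x"
  obtains v \<beta> where "\<forall>w\<in>S. ereal (v \<bullet> w - \<beta>) \<le> h w" and "c < v \<bullet> x - \<beta>"
proof -
  let ?E = "{(v, t::real). v \<in> S \<and> h v \<le> ereal t}"
  obtain w0 t0 where w0: "w0 \<in> S" "h w0 = ereal t0"
    using proper unfolding proper_on_def by (metis ereal_cases)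
  have separate: "\<exists>a s b. 0 \<le> s \<and> a \<bullet> z + s * r < b \<and>
      (\<forall>w\<in>S. \<forall>t. h w \<le> ereal t \<longrightarrow> b < a \<bullet> w + s * t)"
    if z: "z \<in> S" "ereal r < h z" for z r
  proof -
    have "(z, r) \<notin> ?E" using z by auto
    then obtain as b where below: "as \<bullet> (z, r) < b" and above: "\<forall>u\<in>?E. b < as \<bullet> u"
      using separating_hyperplane_closed_point[of ?E "(z, r)"] conv
        closed_epigraph[OF \<open>closed S\<close> lsc] by (auto simp: ereal_convex_on_def)
    obtain a s where as: "as = (a, s)" by (cases as)
    have ab: "b < a \<bullet> w + s * t" if "w \<in> S" "h w \<le> ereal t" for w t
      using above that by (auto simp: as)
    have "0 \<le> s"
    proof (rule ccontr)
      assume "\<not> 0 \<le> s"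
      then have "s < 0" by simp
      \<comment> \<open>The epigraph is unbounded upwards, so a downward normal violates the separation high above \<open>w0\<close>.\<close>
      let ?t = "max t0 ((b - a \<bullet> w0) / s)"
      have "b < a \<bullet> w0 + s * ?t" by (rule ab) (use w0 in auto)
      moreover have "s * ?t \<le> s * ((b - a \<bullet> w0) / s)"
        using \<open>s < 0\<close> by (intro mult_left_mono_neg) auto
      ultimately show False using \<open>s < 0\<close> by simp
    qed
    moreover have "a \<bullet> z + s * r < b" using below by (simp add: as)
    ultimately show ?thesis using ab by blast
  qed
  have nonvertical: "\<exists>v \<beta>. (\<forall>w\<in>S. ereal (v \<bullet> w - \<beta>) \<le> h w) \<and> r < v \<bullet> z - \<beta>"
    if "0 < s" "a \<bullet> z + s * r < b" and ab: "\<forall>w\<in>S. \<forall>t. h w \<le> ereal t \<longrightarrow> b < a \<bullet> w + s * t"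
    for a s b z r
  proof (intro exI conjI ballI)
    fix w assume w: "w \<in> S"
    show "ereal (((- 1 / s) *\<^sub>R a) \<bullet> w - (- b / s)) \<le> h w"
    proof (cases "h w")
      case (real t)
      with ab w have "b < a \<bullet> w + s * t" by simp
      then show ?thesis using \<open>0 < s\<close> real by (simp add: field_simps)
    qed (use proper w in \<open>auto simp: proper_on_def\<close>)
  next
    show "r < ((- 1 / s) *\<^sub>R a) \<bullet> z - (- b / s)" using that by (simp add: field_simps)
  qed
  obtain a s b where "0 \<le> s" and below: "a \<bullet> x + s * c < b"
    and above: "\<forall>w\<in>S. \<forall>t. h w \<le> ereal t \<longrightarrow> b < a \<bullet> w + s * t"
    using separate[OF \<open>x \<in> S\<close> c] by blast
  show thesis
  proof (cases "s = 0")
    case False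
    with \<open>0 \<le> s\<close> have "0 < s" by simp
    from nonvertical[OF this below above] that show thesis by blast
  next
    case True
    obtain a' s' b' where s': "0 \<le> s'" "a' \<bullet> w0 + s' * (t0 - 1) < b'"
      "\<forall>w\<in>S. \<forall>t. h w \<le> ereal t \<longrightarrow> b' < a' \<bullet> w + s' * t"
      using separate[OF w0(1), of "t0 - 1"] w0(2) by auto
    have "b' < a' \<bullet> w0 + s' * t0" using s'(3) w0 by simp
    with s'(2) have "s' \<noteq> 0" by auto
    with s'(1) have "0 < s'" by simp
    from nonvertical[OF this s'(2,3)] obtain v0 \<beta>0
      where minor: "\<And>w. w \<in> S \<Longrightarrow> ereal (v0 \<bullet> w - \<beta>0) \<le> h w" by blast
    \<comment> \<open>The factor \<open>N\<close> lifts the value of the minorant at \<open>x\<close> to more than \<open>c\<close>.\<close>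
    define N where "N = (\<bar>c - (v0 \<bullet> x - \<beta>0)\<bar> + 1) / (b - a \<bullet> x)"
    have pos: "b - a \<bullet> x > 0" using below True by simp
    have "N \<ge> 0" using pos by (simp add: N_def)
    have N: "N * (b - a \<bullet> x) = \<bar>c - (v0 \<bullet> x - \<beta>0)\<bar> + 1" using pos by (simp add: N_def)
    show thesis
    proof (rule that, rule ballI)
      fix w assume w: "w \<in> S"
      show "ereal ((v0 - N *\<^sub>R a) \<bullet> w - (\<beta>0 - N * b)) \<le> h w"
      proof (cases "h w")
        case (real t)
        have "b < a \<bullet> w + s * t" using above w real by simp
        then have "b < a \<bullet> w" using True by simp
        then have "N * (b - a \<bullet> w) \<le> 0" using \<open>N \<ge> 0\<close> by (simp add: mult_nonneg_nonpos)
        moreover have "v0 \<bullet> w - \<beta>0 \<le> t" using minor[OF w] real by simp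
        ultimately show ?thesis using real by (simp add: inner_diff_left algebra_simps)
      qed (use proper w in \<open>auto simp: proper_on_def\<close>)
    next
      show "c < (v0 - N *\<^sub>R a) \<bullet> x - (\<beta>0 - N * b)"
        using N by (simp add: inner_diff_left algebra_simps)
    qed
  qed
qed

text \<open>
  The biconjugate dominates \<open>h\<close>, in the only form needed below: the hypothesis says that the
  biconjugate is at most \<open>\<gamma>\<close> at \<open>x\<close>.
\<close>

lemma le_if_fenchel_conj_ge:
  fixes h :: "'a::euclidean_space \<Rightarrow> ereal"
  assumes "closed S" "proper_on S h" "lsc_on S h" "ereal_convex_on S h" "x \<in> S"
    and conj: "\<And>v. ereal (v \<bullet> x - \<gamma>) \<le> fenchel_conj S h v"
  shows "h x \<le> ereal \<gamma>"
proof (rule ccontr)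
  assume "\<not> h x \<le> ereal \<gamma>"
  then have "ereal \<gamma> < h x" by simp
  from affine_minorant_above[OF assms(1-5) this]
  obtain v \<beta> where minor: "\<forall>w\<in>S. ereal (v \<bullet> w - \<beta>) \<le> h w" and \<beta>: "\<gamma> < v \<bullet> x - \<beta>"
    by blast
  have "fenchel_conj S h v \<le> ereal \<beta>"
    by (rule fenchel_conj_leI) (use minor in blast)
  with conj[of v] have "ereal (v \<bullet> x - \<gamma>) \<le> ereal \<beta>" by (blast intro: order_trans)
  with \<beta> show False by simp
qed

lemma fenchel_conj_finite:
  fixes h :: "'a::euclidean_space \<Rightarrow> ereal"
  assumes "closed S" and proper: "proper_on S h" and "lsc_on S h" "ereal_convex_on S h"
  obtains v where "fenchel_conj S h v \<noteq> \<infinity>"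
proof -
  obtain x t where x: "x \<in> S" "h x = ereal t"
    using proper unfolding proper_on_def by (metis ereal_cases)
  have "ereal (t - 1) < h x" by (simp add: x)
  from affine_minorant_above[OF assms x(1) this]
  obtain v \<beta> where minor: "\<forall>w\<in>S. ereal (v \<bullet> w - \<beta>) \<le> h w"
    by blast
  have "fenchel_conj S h v \<le> ereal \<beta>"
    by (rule fenchel_conj_leI) (use minor in blast)
  then have "fenchel_conj S h v \<noteq> \<infinity>" by auto
  then show thesis by (rule that)
qed

lemma norm_add_scaleR_sq:
  fixes a b :: "'a::real_inner"
  shows "(norm (a + t *\<^sub>R b))\<^sup>2 = (norm a)\<^sup>2 + 2 * t * (a \<bullet> b) + t * (t * (norm b)\<^sup>2)"
  by (simp add: power2_norm_eq_inner inner_add_left inner_add_right inner_commute algebra_simps)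

text \<open>
  First-order optimality for the proximal step: \<open>q - (z - w) / \<sigma>\<close> is a subgradient of the conjugate
  at the maximizer \<open>z\<close>. Comparing \<open>z\<close> with points on the segment to \<open>v\<close>, the gain is linear and the
  quadratic penalty of second order in the step \<open>t\<close>, so the linear coefficient cannot be positive.
\<close>

lemma proximal_argmax_subgradient:
  fixes h :: "'a::real_inner \<Rightarrow> ereal"
  assumes "convex S" and proper: "proper_on S h"
    and argmax: "is_arg_max
      (\<lambda>v. ereal (q \<bullet> v) - fenchel_conj S h v - ereal (1 / (2 * \<sigma>) * (norm (v - w))\<^sup>2))
      (\<lambda>v. v \<in> S) z"
    and "\<sigma> > 0"
    and v: "v \<in> S" "fenchel_conj S h v = ereal d"
  obtains c where "fenchel_conj S h z = ereal c"
    and "(q - (1 / \<sigma>) *\<^sub>R (z - w)) \<bullet> (v - z) \<le> d - c"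
proof -
  let ?\<phi> = "\<lambda>v. ereal (q \<bullet> v) - fenchel_conj S h v - ereal (1 / (2 * \<sigma>) * (norm (v - w))\<^sup>2)"
  have "z \<in> S" and max: "?\<phi> u \<le> ?\<phi> z" if "u \<in> S" for u
    using argmax that by (auto simp: is_arg_max_def not_less)
  from v(1) this(1) have "z \<in> S" by blast
  have "fenchel_conj S h z \<noteq> \<infinity>" using max[OF v(1)] v(2) by auto
  then obtain c where c: "fenchel_conj S h z = ereal c"
    using fenchel_conj_not_MInfty[OF proper, of z] by (cases "fenchel_conj S h z") auto
  define e where "e = (q - (1 / \<sigma>) *\<^sub>R (z - w)) \<bullet> (v - z) - (d - c)"
  define K where "K = (norm (v - z))\<^sup>2 / (2 * \<sigma>)"
  have "K \<ge> 0" using \<open>\<sigma> > 0\<close> by (simp add: K_def)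
  have small: "e \<le> t * K" if t: "0 < t" "t < 1" for t
  proof -
    let ?u = "(1 - t) *\<^sub>R z + t *\<^sub>R v"
    have "?u \<in> S" using \<open>convex S\<close> \<open>z \<in> S\<close> v(1) t by (simp add: convex_alt)
    have le: "fenchel_conj S h ?u \<le> ereal ((1 - t) * c + t * d)"
      using fenchel_conj_convex[OF proper c v(2)] t by simp
    then obtain r where r: "fenchel_conj S h ?u = ereal r"
      using fenchel_conj_not_MInfty[OF proper, of ?u] by (cases "fenchel_conj S h ?u") auto
    have "q \<bullet> ?u - r - 1 / (2 * \<sigma>) * (norm (?u - w))\<^sup>2 \<le> q \<bullet> z - c - 1 / (2 * \<sigma>) * (norm (z - w))\<^sup>2"
      using max[OF \<open>?u \<in> S\<close>] by (simp add: r c)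
    moreover have "r \<le> (1 - t) * c + t * d" using le r by simp
    moreover have "q \<bullet> ?u = q \<bullet> z + t * (q \<bullet> (v - z))"
      by (simp add: inner_add_right inner_diff_right algebra_simps)
    moreover have "1 / (2 * \<sigma>) * (norm (?u - w))\<^sup>2 =
        1 / (2 * \<sigma>) * (norm (z - w))\<^sup>2 + t * ((1 / \<sigma>) * ((z - w) \<bullet> (v - z))) + t * (t * K)"
    proof -
      have "?u - w = (z - w) + t *\<^sub>R (v - z)" by (simp add: algebra_simps)
      then have "(norm (?u - w))\<^sup>2 =
          (norm (z - w))\<^sup>2 + 2 * t * ((z - w) \<bullet> (v - z)) + t * (t * (norm (v - z))\<^sup>2)"
        by (simp only: norm_add_scaleR_sq)
      then show ?thesis using \<open>\<sigma> > 0\<close> by (simp add: K_def field_simps)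
    qed
    ultimately have "t * e \<le> t * (t * K)"
      by (simp add: e_def inner_diff_left algebra_simps)
    then show ?thesis using t by simp
  qed
  have "e \<le> 0"
  proof (rule ccontr)
    assume "\<not> e \<le> 0"
    then have "e > 0" by simp
    \<comment> \<open>The step \<open>t = e / (e + K + 1)\<close> lies between \<open>0\<close> and \<open>1\<close> and is so short that \<open>t * K < e\<close>.\<close>
    have "e \<le> e / (e + K + 1) * K"
      by (rule small) (use \<open>e > 0\<close> \<open>K \<ge> 0\<close> in \<open>auto simp: field_simps\<close>)
    then have "e * (e + 1) \<le> 0" using \<open>e > 0\<close> \<open>K \<ge> 0\<close> by (simp add: field_simps)
    then show False using \<open>e > 0\<close> by (simp add: mult_le_0_iff)
  qed
  with c that show thesis by (simp add: e_def)
qed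

section \<open>The smallest eigenvalue as a Rayleigh bound\<close>

lemma inner_matrix_vector:
  fixes B :: "real^'m::finite^'n::finite"
  shows "x \<bullet> (B *v y) = (transpose B *v x) \<bullet> y"
  by (simp add: dot_lmul_matrix)

lemma norm_matrix_vector_sq:
  fixes B :: "real^'m::finite^'n::finite"
  shows "(norm (B *v v))\<^sup>2 = v \<bullet> ((transpose B ** B) *v v)"
  unfolding power2_norm_eq_inner inner_matrix_vector[of "B *v v"] matrix_vector_mul_assoc
  by (rule inner_commute)

text \<open>
  Eigenvectors to different eigenvalues are orthogonal, and an orthogonal set in a Euclidean space
  is finite. Finiteness is needed because a minimum over an infinite set would be unspecified.
\<close>

lemma finite_eigenvalues_symmetric:
  fixes M :: "real^'m::finite^'m"
  assumes sym: "transpose M = M"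
  shows "finite {l. \<exists>v. v \<noteq> 0 \<and> M *v v = l *\<^sub>R v}" (is "finite ?E")
proof -
  define e where "e l = (SOME v. v \<noteq> 0 \<and> M *v v = l *\<^sub>R v)" for l
  have e: "e l \<noteq> 0 \<and> M *v e l = l *\<^sub>R e l" if "l \<in> ?E" for l
    unfolding e_def by (rule someI_ex) (use that in simp)
  have orth: "e l \<bullet> e l' = 0" if "l \<in> ?E" "l' \<in> ?E" "l \<noteq> l'" for l l'
  proof -
    have "e l \<bullet> (M *v e l') = (M *v e l) \<bullet> e l'" by (simp only: inner_matrix_vector sym)
    with e[OF that(1)] e[OF that(2)] have "l' * (e l \<bullet> e l') = l * (e l \<bullet> e l')" by simp
    with that(3) show ?thesis by simp
  qed
  have "inj_on e ?E"
  proof (rule inj_onI, rule ccontr)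
    fix l l' assume l: "l \<in> ?E" "l' \<in> ?E" "e l = e l'" "l \<noteq> l'"
    with orth[of l l'] e[OF l(1)] show False by simp
  qed
  moreover have "finite (e ` ?E)"
  proof (rule pairwise_orthogonal_imp_finite)
    show "pairwise orthogonal (e ` ?E)"
      unfolding pairwise_def orthogonal_def using orth by blast
  qed
  ultimately show ?thesis by (simp add: finite_image_iff)
qed

text \<open>
  A minimizer \<open>v\<close> of the quadratic form on the compact unit sphere is an eigenvector: the form minus
  \<open>l * (norm w)\<^sup>2\<close> is nonnegative and vanishes at \<open>v\<close>, so its variation in the direction of the
  residual \<open>u\<close> must vanish, which forces \<open>u = 0\<close>.
\<close>

lemma rayleigh_minimizer_eigenvector:
  fixes M :: "real^'m::finite^'m"
  assumes sym: "transpose M = M"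
  obtains l v where "v \<noteq> 0" "M *v v = l *\<^sub>R v" "\<And>w. l * (norm w)\<^sup>2 \<le> w \<bullet> (M *v w)"
proof -
  have cont: "continuous_on (sphere 0 1) (\<lambda>w::real^'m. w \<bullet> (M *v w))"
    by (intro continuous_intros linear_continuous_on linear_linear[THEN iffD1] matrix_vector_mul_linear)
       simp
  have "sphere (0::real^'m) 1 \<noteq> {}" by simp
  then obtain v where v: "norm v = 1" and min: "\<And>w. norm w = 1 \<Longrightarrow> v \<bullet> (M *v v) \<le> w \<bullet> (M *v w)"
    using continuous_attains_inf[OF compact_sphere _ cont] by auto
  define l where "l = v \<bullet> (M *v v)"
  have ray: "l * (norm w)\<^sup>2 \<le> w \<bullet> (M *v w)" for w
  proof (cases "w = 0")
    case False
    have "norm ((1 / norm w) *\<^sub>R w) = 1" using False by simp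
    from min[OF this] have "l \<le> (1 / norm w) * ((1 / norm w) * (w \<bullet> (M *v w)))"
      by (simp add: l_def matrix_vector_mult_scaleR)
    then show ?thesis using False by (simp add: field_simps power2_eq_square)
  qed simp
  define u where "u = M *v v - l *\<^sub>R v"
  define q where "q = u \<bullet> (M *v u) - l * (norm u)\<^sup>2"
  have "q \<ge> 0" using ray[of u] by (simp add: q_def)
  have expand: "0 \<le> 2 * t * (norm u)\<^sup>2 + t * (t * q)" for t
  proof -
    have cross: "v \<bullet> (M *v u) = u \<bullet> (M *v v)"
      by (simp only: inner_matrix_vector[of v] sym inner_commute)
    have "(v + t *\<^sub>R u) \<bullet> (M *v (v + t *\<^sub>R u)) =
        l + 2 * t * (u \<bullet> (M *v v)) + t * (t * (u \<bullet> (M *v u)))"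
      by (simp add: matrix_vector_right_distrib matrix_vector_mult_scaleR inner_add_left
          inner_add_right cross l_def algebra_simps)
    moreover note ray[of "v + t *\<^sub>R u"]
    moreover have "(norm (v + t *\<^sub>R u))\<^sup>2 = 1 + 2 * t * (u \<bullet> v) + t * (t * (norm u)\<^sup>2)"
      by (simp add: norm_add_scaleR_sq v inner_commute)
    ultimately have "l * (1 + 2 * t * (u \<bullet> v) + t * (t * (norm u)\<^sup>2)) \<le>
        l + 2 * t * (u \<bullet> (M *v v)) + t * (t * (u \<bullet> (M *v u)))"
      by (simp only:)
    moreover have "(norm u)\<^sup>2 = u \<bullet> (M *v v) - l * (u \<bullet> v)"
      unfolding power2_norm_eq_inner by (subst (2) u_def) (simp add: inner_diff_right)
    then have "2 * t * (norm u)\<^sup>2 = 2 * t * (u \<bullet> (M *v v)) - 2 * t * (l * (u \<bullet> v))"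
      by (simp add: right_diff_distrib)
    ultimately show ?thesis by (simp add: q_def algebra_simps)
  qed
  have "(norm u)\<^sup>2 \<le> 0"
  proof (rule ccontr)
    assume "\<not> (norm u)\<^sup>2 \<le> 0"
    then have U: "(norm u)\<^sup>2 > 0" by simp
    \<comment> \<open>Near the minimizer of the quadratic in \<open>expand\<close>; the \<open>+ 1\<close> covers \<open>q = 0\<close>.\<close>
    define t where "t = (norm u)\<^sup>2 / (q + 1)"
    have t: "t > 0" using U \<open>q \<ge> 0\<close> by (simp add: t_def)
    have "0 \<le> t * (t * q - 2 * (norm u)\<^sup>2)" using expand[of "- t"] by (simp add: algebra_simps)
    then have "2 * (norm u)\<^sup>2 \<le> t * q" using t by (simp add: zero_le_mult_iff)
    also have "t * q \<le> (norm u)\<^sup>2" using U \<open>q \<ge> 0\<close> by (simp add: t_def field_simps)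
    finally show False using U by simp
  qed
  then have "M *v v = l *\<^sub>R v" by (simp add: u_def)
  moreover have "v \<noteq> 0" using v by auto
  ultimately show thesis using ray that by blast
qed

lemma lambda_min_eigenvalue:
  fixes M :: "real^'m::finite^'m"
  assumes "transpose M = M"
  obtains v where "v \<noteq> 0" "M *v v = lambda_min M *\<^sub>R v"
proof -
  let ?E = "{l. \<exists>v\<in>UNIV. v \<noteq> 0 \<and> M *v v = l *\<^sub>R v}"
  have "finite ?E" using finite_eigenvalues_symmetric[OF assms] by simp
  moreover obtain l v where "v \<noteq> 0" "M *v v = l *\<^sub>R v"
    by (rule rayleigh_minimizer_eigenvector[OF assms])
  then have "?E \<noteq> {}" by blast
  ultimately have "lambda_min M \<in> ?E" unfolding lambda_min_on_def by (rule Min_in)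
  with that show thesis by blast
qed

lemma lambda_min_rayleigh:
  fixes M :: "real^'m::finite^'m"
  assumes "transpose M = M"
  shows "lambda_min M * (norm w)\<^sup>2 \<le> w \<bullet> (M *v w)"
proof -
  obtain l v where l: "v \<noteq> 0" "M *v v = l *\<^sub>R v" and ray: "\<And>w. l * (norm w)\<^sup>2 \<le> w \<bullet> (M *v w)"
    using rayleigh_minimizer_eigenvector[OF assms] by blast
  have "lambda_min M \<le> l"
    unfolding lambda_min_on_def
    by (rule Min_le) (use finite_eigenvalues_symmetric[OF assms] l in auto)
  then have "lambda_min M * (norm w)\<^sup>2 \<le> l * (norm w)\<^sup>2" by (rule mult_right_mono) simp
  also note ray
  finally show ?thesis .
qed

lemma transpose_gram: "transpose (transpose B ** B) = transpose B ** (B :: real^'m::finite^'n::finite)"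
  by (simp add: matrix_transpose_mul)

lemma lambda_min_gram_le:
  fixes B :: "real^'m::finite^'n::finite"
  shows "lambda_min (transpose B ** B) * (norm v)\<^sup>2 \<le> (norm (B *v v))\<^sup>2"
  using lambda_min_rayleigh[OF transpose_gram, of B v] by (simp only: norm_matrix_vector_sq)

lemma lambda_min_gram_nonneg:
  fixes B :: "real^'m::finite^'n::finite"
  shows "0 \<le> lambda_min (transpose B ** B)"
proof -
  obtain v where "v \<noteq> 0" and v: "(transpose B ** B) *v v = lambda_min (transpose B ** B) *\<^sub>R v"
    by (rule lambda_min_eigenvalue[OF transpose_gram])
  have "0 \<le> lambda_min (transpose B ** B) * (norm v)\<^sup>2"
    using zero_le_power2[of "norm (B *v v)"]
    unfolding norm_matrix_vector_sq v by (simp add: power2_norm_eq_inner)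
  with \<open>v \<noteq> 0\<close> show ?thesis by (simp add: zero_le_mult_iff)
qed

text \<open>
  For \<open>s = \<tau> * \<sigma>\<close> this is the positive semidefiniteness of \<open>G_matrix\<close>. The operator
  norm is positive here because the reciprocal of \<open>0\<close> is \<open>0\<close> and \<open>s\<close> is positive.
\<close>

lemma step_size_bound:
  fixes B :: "real^'m::finite^'n::finite"
  assumes "0 < s" and s: "s \<le> 1 / onorm (\<lambda>y. (transpose B ** B) *v y)"
  shows "s * (norm (B *v v))\<^sup>2 \<le> (norm v)\<^sup>2"
proof -
  let ?T = "\<lambda>y. (transpose B ** B) *v y"
  have "0 < 1 / onorm ?T" using assms by (rule less_le_trans)
  then have pos: "onorm ?T > 0" by (simp add: zero_less_divide_iff)
  have T: "bounded_linear ?T" by simp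
  have "(norm (B *v v))\<^sup>2 \<le> norm v * norm (?T v)"
    unfolding norm_matrix_vector_sq by (rule norm_cauchy_schwarz)
  also have "\<dots> \<le> norm v * (onorm ?T * norm v)"
    by (intro mult_left_mono onorm[OF T]) simp
  also have "\<dots> = onorm ?T * (norm v)\<^sup>2" by (simp only: power2_eq_square mult.left_commute)
  finally have "s * (norm (B *v v))\<^sup>2 \<le> s * (onorm ?T * (norm v)\<^sup>2)"
    by (rule mult_left_mono) (use \<open>0 < s\<close> in simp)
  also have "\<dots> = (s * onorm ?T) * (norm v)\<^sup>2" by (rule mult.assoc[symmetric])
  also have "\<dots> \<le> 1 * (norm v)\<^sup>2"
  proof (rule mult_right_mono)
    show "s * onorm ?T \<le> 1" using s pos by (simp only: pos_le_divide_eq)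
  qed simp
  finally show ?thesis by simp
qed

lemma sqnorm_H_eq:
  fixes B :: "real^'m::finite^'n::finite"
  shows "sqnorm_H \<tau> \<sigma> B (x, y) = (norm x)\<^sup>2 / \<tau> + (norm y)\<^sup>2 / \<sigma> - \<tau> * (norm (B *v y))\<^sup>2"
proof -
  have "mat c *v v = c *\<^sub>R v" for c and v :: "real^'m"
    by (simp add: vec_eq_iff matrix_vector_mult_def mat_def if_distrib[of "\<lambda>z. z * _"] cong: if_cong)
  then have "y \<bullet> (G_matrix \<tau> \<sigma> B *v y) = (norm y)\<^sup>2 / \<sigma> - \<tau> * (norm (B *v y))\<^sup>2"
    by (simp add: G_matrix_def matrix_vector_mult_diff_rdistrib norm_matrix_vector_sq
        scaleR_matrix_vector_assoc[symmetric] inner_diff_right power2_norm_eq_inner[of y]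
        del: transpose_matrix_vector)
  then show ?thesis by (simp add: sqnorm_H_def)
qed

section \<open>Block decomposition\<close>

lemma blk_part_in_blk_space [simp]: "blk_part blk i v \<in> blk_space blk i"
  by (simp add: blk_space_def blk_part_def)

lemma blk_part_ident: "v \<in> blk_space blk i \<Longrightarrow> blk_part blk i v = v"
  by (auto simp: blk_space_def blk_part_def vec_eq_iff)

lemma blk_part_diff: "blk_part blk i (u - v) = blk_part blk i u - blk_part blk i v"
  by (auto simp: blk_part_def vec_eq_iff)

lemma blk_part_update:
  "blk_part blk j (u + blk_part blk i (v - u)) = (if j = i then blk_part blk i v else blk_part blk j u)"
  by (auto simp: blk_part_def vec_eq_iff)

lemma inner_blk_part_left: "blk_part blk i u \<bullet> v = u \<bullet> blk_part blk i v"
  by (auto simp: blk_part_def inner_vec_def intro!: sum.cong)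

lemma inner_blk_part:
  "u \<in> blk_space blk i \<Longrightarrow> u \<bullet> blk_part blk i v = u \<bullet> v"
  by (metis inner_blk_part_left blk_part_ident)

lemma sum_blk_part: "(\<Sum>i\<in>UNIV. blk_part blk i v) = v" for blk :: "'m::finite \<Rightarrow> 'p::finite"
  by (simp add: vec_eq_iff sum_component blk_part_def)

lemma sum_inner_blk_part:
  "(\<Sum>i\<in>UNIV. blk_part blk i u \<bullet> blk_part blk i v) = u \<bullet> v" for blk :: "'m::finite \<Rightarrow> 'p::finite"
  by (simp add: inner_blk_part inner_sum_left[symmetric] sum_blk_part)

lemma convex_blk_space: "convex (blk_space blk i)"
  by (auto simp: convex_alt blk_space_def)

lemma closed_blk_space: "closed (blk_space blk i)"
proof -
  have "blk_space blk i = (\<Inter>j\<in>{j. blk j \<noteq> i}. {y. y $ j = 0})" by (auto simp: blk_space_def)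
  also have "closed \<dots>"
    by (intro closed_INT ballI closed_Collect_eq continuous_intros)
  finally show ?thesis .
qed

lemma fenchel_conj_blk_part:
  "fenchel_conj (blk_space blk i) h (blk_part blk i v) = fenchel_conj (blk_space blk i) h v"
  unfolding fenchel_conj_def
  by (intro SUP_cong refl) (simp add: inner_blk_part_left blk_part_ident)

lemma transpose_blk_matrix_in_blk_space:
  "blk_matrix blk i B \<Longrightarrow> transpose B *v x \<in> blk_space blk i"
  by (simp add: blk_matrix_def blk_space_def matrix_vector_mult_def transpose_def
      del: transpose_matrix_vector)

lemma calA_mult: "calA A *v v = (\<Sum>i\<in>UNIV. A i *v v)"
  by (simp add: calA_def vec_eq_iff matrix_vector_mult_def sum_component sum_distrib_right)
     (auto intro: sum.swap)

lemma inner_calA: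
  assumes "\<And>i. blk_matrix blk i (A i)"
  shows "x \<bullet> (calA A *v v) = (\<Sum>i\<in>UNIV. (transpose (A i) *v x) \<bullet> blk_part blk i v)"
proof -
  have "(transpose (A i) *v x) \<bullet> blk_part blk i v = x \<bullet> (A i *v v)" for i
    by (simp only: inner_blk_part[OF transpose_blk_matrix_in_blk_space[OF assms]] inner_matrix_vector)
  then show ?thesis by (simp only: calA_mult inner_sum_right)
qed

lemma inner_calA_blk_part:
  assumes "\<And>i. blk_matrix blk i (A i)"
  shows "x \<bullet> (calA A *v blk_part blk i v) = (transpose (A i) *v x) \<bullet> v"
proof -
  have "blk_part blk j (blk_part blk i v) = (if j = i then blk_part blk i v else 0)" for j
    by (auto simp: blk_part_def vec_eq_iff)
  then have "x \<bullet> (calA A *v blk_part blk i v) =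
      (\<Sum>j\<in>UNIV. if j = i then (transpose (A i) *v x) \<bullet> blk_part blk i v else 0)"
    unfolding inner_calA[OF assms] by (intro sum.cong) auto
  also have "\<dots> = (transpose (A i) *v x) \<bullet> v"
    by (simp only: sum.delta[OF finite] UNIV_I if_True
        inner_blk_part[OF transpose_blk_matrix_in_blk_space[OF assms]])
  finally show ?thesis .
qed

section \<open>Saddle points\<close>

lemma sum_ereal_finite:
  fixes h :: "'p::finite \<Rightarrow> ereal"
  assumes "\<And>i. h i \<noteq> \<infinity>" "\<And>i. h i \<noteq> - \<infinity>"
  shows "(\<Sum>i\<in>UNIV. h i) = ereal (\<Sum>i\<in>UNIV. real_of_ereal (h i))"
proof -
  have "h i = ereal (real_of_ereal (h i))" for i
    using assms[of i] by (cases "h i") auto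
  then have "(\<Sum>i\<in>UNIV. h i) = (\<Sum>i\<in>UNIV. ereal (real_of_ereal (h i)))" by simp
  then show ?thesis by simp
qed

text \<open>
  Maximality of the Lagrangian in \<open>y\<close> says that \<open>yh\<close> splits into blocks at which the conjugates
  are finite and have \<open>transpose (A i) *v xh\<close> as a subgradient. Finiteness holds since some dual point has a
  finite Lagrangian value and \<open>yh\<close> is at least as good; the subgradient inequality comes from
  changing a single block of \<open>yh\<close>.
\<close>

lemma saddle_point_optimality:
  fixes A :: "'p::finite \<Rightarrow> real^'m::finite^'n::finite" and blk :: "'m \<Rightarrow> 'p"
  assumes blocks: "\<And>i. blk_matrix blk i (A i)"
    and proper: "\<And>i. proper_on (blk_space blk i) (g i)"
    and lsc: "\<And>i. lsc_on (blk_space blk i) (g i)"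
    and conv: "\<And>i. ereal_convex_on (blk_space blk i) (g i)"
    and saddle: "saddle_point (lagrangian f blk g A) (xh, yh)"
  obtains c where "\<And>i. fenchel_conj (blk_space blk i) (g i) (blk_part blk i yh) = ereal (c i)"
    and "\<And>i v. ereal ((transpose (A i) *v xh) \<bullet> (v - yh) + c i) \<le> fenchel_conj (blk_space blk i) (g i) v"
    and "\<And>x. f xh + xh \<bullet> (calA A *v yh) \<le> f x + x \<bullet> (calA A *v yh)"
proof -
  define F where "F i v = fenchel_conj (blk_space blk i) (g i) v" for i v
  define K where "K = lagrangian f blk g A"
  have K: "K x y = ereal (f x + x \<bullet> (calA A *v y)) - (\<Sum>i\<in>UNIV. F i (blk_part blk i y))" for x y
    by (simp add: K_def lagrangian_def F_def)
  have F_part: "F i (blk_part blk i v) = F i v" for i v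
    unfolding F_def by (rule fenchel_conj_blk_part)
  have F_MInf: "F i v \<noteq> - \<infinity>" for i v
    unfolding F_def by (rule fenchel_conj_not_MInfty[OF proper])
  have max: "K xh y \<le> K xh yh" and min: "K xh yh \<le> K x yh" for x y
    using saddle by (simp_all add: saddle_point_def K_def)
  have "\<exists>v. F i v \<noteq> \<infinity>" for i
    unfolding F_def by (rule fenchel_conj_finite[OF closed_blk_space proper lsc conv]) blast
  then obtain w where w: "\<And>i. F i (w i) \<noteq> \<infinity>" using choice by metis
  \<comment> \<open>A dual point with all blocks in the domains of the conjugates.\<close>
  define y0 where "y0 = (\<chi> j. w (blk j) $ j)"
  have "blk_part blk i y0 = blk_part blk i (w i)" for i
    by (simp add: vec_eq_iff blk_part_def y0_def)
  then have F_y0: "F i (blk_part blk i y0) \<noteq> \<infinity>" for i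
    using w[of i] by (simp add: F_part)
  have K_y0: "K xh y0 \<noteq> - \<infinity>"
    by (simp add: K sum_ereal_finite F_y0 F_MInf)
  have F_yh: "F i (blk_part blk i yh) \<noteq> \<infinity>" for i
  proof
    assume "F i (blk_part blk i yh) = \<infinity>"
    then have "(\<Sum>i\<in>UNIV. F i (blk_part blk i yh)) = \<infinity>" by (auto simp: sum_Pinfty)
    then have "K xh yh = - \<infinity>" by (simp add: K)
    with max[of y0] K_y0 show False by simp
  qed
  define c where "c i = real_of_ereal (F i (blk_part blk i yh))" for i
  have c: "F i (blk_part blk i yh) = ereal (c i)" for i
    using F_yh[of i] F_MInf[of i "blk_part blk i yh"] unfolding c_def
    by (cases "F i (blk_part blk i yh)") auto
  have K_yh: "K x yh = ereal (f x + x \<bullet> (calA A *v yh) - (\<Sum>i\<in>UNIV. c i))" for x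
    by (simp add: K c)
  have sub: "ereal ((transpose (A i) *v xh) \<bullet> (v - yh) + c i) \<le> F i v" for i v
  proof (cases "F i v")
    case (real d)
    let ?y = "yh + blk_part blk i (v - yh)"
    have "F j (blk_part blk j ?y) = ereal (if j = i then d else c j)" for j
      using c[of j] by (simp add: blk_part_update F_part real)
    moreover have "(\<Sum>j\<in>UNIV. if j = i then d else c j) = (\<Sum>j\<in>UNIV. c j) - c i + d"
      by (simp add: sum.remove[of UNIV i])
    ultimately have "K xh ?y = ereal (f xh + xh \<bullet> (calA A *v ?y) - ((\<Sum>j\<in>UNIV. c j) - c i + d))"
      by (simp add: K)
    moreover have "xh \<bullet> (calA A *v ?y) = xh \<bullet> (calA A *v yh) + (transpose (A i) *v xh) \<bullet> (v - yh)"
      by (simp only: matrix_vector_right_distrib inner_add_right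
          inner_calA_blk_part[where blk=blk, OF blocks])
    ultimately have "(transpose (A i) *v xh) \<bullet> (v - yh) + c i \<le> d"
      using max[of ?y] K_yh[of xh] by (simp del: transpose_matrix_vector)
    then show ?thesis using real by simp
  qed (use F_MInf in auto)
  have opt: "f xh + xh \<bullet> (calA A *v yh) \<le> f x + x \<bullet> (calA A *v yh)" for x
    using min[of x] by (simp add: K_yh)
  show thesis
    by (rule that[of c]) (use c sub opt in \<open>simp_all add: F_def\<close>)
qed

text \<open>
  The Lagrangian at \<open>(z, yh)\<close> bounds the primal objective at \<open>z\<close> from below, by the Fenchel-Young
  inequality. At \<open>xh\<close> the bound is attained: the subgradient inequalities bound the biconjugates of
  the \<open>g i\<close> from above, and these coincide with the \<open>g i\<close> by closedness and convexity.
  This is what makes the quadratic support of \<open>f\<close> available at \<open>xh\<close>.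
\<close>

lemma saddle_point_imp_primal_solution:
  fixes A :: "'p::finite \<Rightarrow> real^'m::finite^'n::finite" and blk :: "'m \<Rightarrow> 'p"
  assumes blocks: "\<And>i. blk_matrix blk i (A i)"
    and proper: "\<And>i. proper_on (blk_space blk i) (g i)"
    and lsc: "\<And>i. lsc_on (blk_space blk i) (g i)"
    and conv: "\<And>i. ereal_convex_on (blk_space blk i) (g i)"
    and saddle: "saddle_point (lagrangian f blk g A) (xh, yh)"
  shows "xh \<in> primal_solutions f g A"
proof -
  obtain c where c: "\<And>i. fenchel_conj (blk_space blk i) (g i) (blk_part blk i yh) = ereal (c i)"
    and sub: "\<And>i v. ereal ((transpose (A i) *v xh) \<bullet> (v - yh) + c i)
      \<le> fenchel_conj (blk_space blk i) (g i) v"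
    and opt: "\<And>x. f xh + xh \<bullet> (calA A *v yh) \<le> f x + x \<bullet> (calA A *v yh)"
    using saddle_point_optimality[OF assms] by blast
  define \<gamma> where "\<gamma> z i = (transpose (A i) *v z) \<bullet> yh - c i" for z i
  have mem: "transpose (A i) *v z \<in> blk_space blk i" for i z
    by (rule transpose_blk_matrix_in_blk_space[OF blocks])
  have sum_\<gamma>: "(\<Sum>i\<in>UNIV. ereal (\<gamma> z i)) = ereal (z \<bullet> (calA A *v yh) - (\<Sum>i\<in>UNIV. c i))" for z
    unfolding inner_calA[where blk=blk, OF blocks] inner_blk_part[OF mem]
    by (simp add: \<gamma>_def sum_subtractf)
  have lower: "ereal (\<gamma> z i) \<le> g i (transpose (A i) *v z)" for z i
  proof -
    have "blk_part blk i yh \<bullet> (transpose (A i) *v z) = (transpose (A i) *v z) \<bullet> yh"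
      by (simp only: inner_commute[of "blk_part blk i yh"] inner_blk_part[OF mem])
    with fenchel_young[OF mem[of i z], of "blk_part blk i yh" "g i"] proper[of i] mem[of i z]
    show ?thesis
      unfolding c \<gamma>_def proper_on_def
      by (cases "g i (transpose (A i) *v z)") (auto simp del: transpose_matrix_vector)
  qed
  have upper: "g i (transpose (A i) *v xh) \<le> ereal (\<gamma> xh i)" for i
  proof (rule le_if_fenchel_conj_ge[OF closed_blk_space proper lsc conv mem])
    fix v
    have "v \<bullet> (transpose (A i) *v xh) - \<gamma> xh i = (transpose (A i) *v xh) \<bullet> (v - yh) + c i"
      by (simp add: \<gamma>_def inner_diff_right inner_commute[of v] del: transpose_matrix_vector)
    with sub[of i v] show "ereal (v \<bullet> (transpose (A i) *v xh) - \<gamma> xh i)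
        \<le> fenchel_conj (blk_space blk i) (g i) v"
      by (simp only:)
  qed
  let ?\<kappa> = "ereal (f xh + xh \<bullet> (calA A *v yh) - (\<Sum>i\<in>UNIV. c i))"
  have "primal f g A xh \<le> ereal (f xh) + (\<Sum>i\<in>UNIV. ereal (\<gamma> xh i))"
    unfolding primal_def by (intro add_left_mono sum_mono upper)
  then have xh: "primal f g A xh \<le> ?\<kappa>" unfolding sum_\<gamma> by (simp add: add_diff_eq)
  have "?\<kappa> \<le> primal f g A z" for z
  proof -
    have "?\<kappa> \<le> ereal (f z) + (\<Sum>i\<in>UNIV. ereal (\<gamma> z i))"
      unfolding sum_\<gamma> using opt[of z] by (simp add: add_diff_eq)
    also have "\<dots> \<le> primal f g A z"
      unfolding primal_def by (intro add_left_mono sum_mono lower)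
    finally show ?thesis .
  qed
  moreover have "primal f g A xh < \<infinity>" using xh by (rule le_less_trans) simp
  ultimately show ?thesis using xh by (auto simp: primal_solutions_def intro: order_trans)
qed

lemma gderiv_zero_at_minimum:
  fixes f :: "'a::real_inner \<Rightarrow> real"
  assumes deriv: "GDERIV f x :> D" and min: "\<And>z. f x \<le> f z"
  shows "D = 0"
proof -
  have "(f has_derivative (\<lambda>h. h \<bullet> D)) (at x)" using deriv by (simp add: gderiv_def)
  then have "(\<lambda>h. h \<bullet> D) = (\<lambda>h. 0)"
    by (rule differential_zero_maxmin[OF UNIV_I open_UNIV]) (use min in auto)
  from fun_cong[OF this, of D] show ?thesis by simp
qed

lemma saddle_point_gradient:
  fixes f :: "'a::real_inner \<Rightarrow> real"
  assumes deriv: "GDERIV f x :> D" and min: "\<And>z. f x + x \<bullet> w \<le> f z + z \<bullet> w"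
  shows "D + w = 0"
proof (rule gderiv_zero_at_minimum)
  show "GDERIV (\<lambda>z. f z + z \<bullet> w) x :> D + w"
    using deriv unfolding gderiv_def by (auto intro!: derivative_eq_intros simp: inner_add_right)
qed (rule min)

section \<open>One iteration\<close>

text \<open>
  In each block \<open>transpose (A i) *v p - (y' - y) / \<sigma>\<close> is a subgradient of the conjugate at \<open>y'\<close> and
  \<open>transpose (A i) *v xh\<close> is one at \<open>yh\<close>. Subgradients are monotone; the claim is the sum of these
  monotonicity inequalities over the blocks.
\<close>

lemma papc_dual_monotone:
  fixes A :: "'p::finite \<Rightarrow> real^'m::finite^'n::finite" and blk :: "'m \<Rightarrow> 'p"
  assumes blocks: "\<And>i. blk_matrix blk i (A i)"
    and proper: "\<And>i. proper_on (blk_space blk i) (g i)"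
    and c: "\<And>i. fenchel_conj (blk_space blk i) (g i) (blk_part blk i yh) = ereal (c i)"
    and sub: "\<And>i v. ereal ((transpose (A i) *v xh) \<bullet> (v - yh) + c i)
      \<le> fenchel_conj (blk_space blk i) (g i) v"
    and "\<sigma> > 0"
    and argmax: "\<And>i. is_arg_max
             (\<lambda>v. ereal ((transpose (A i) *v p) \<bullet> v)
                   - fenchel_conj (blk_space blk i) (g i) v
                   - ereal (1 / (2 * \<sigma>) * (norm (v - blk_part blk i y))\<^sup>2))
             (\<lambda>v. v \<in> blk_space blk i)
             (blk_part blk i y')"
  shows "(1 / \<sigma>) * ((y' - y) \<bullet> (y' - yh)) \<le> (p - xh) \<bullet> (calA A *v (y' - yh))"
proof -
  have block: "(1 / \<sigma>) * (blk_part blk i (y' - y) \<bullet> blk_part blk i (y' - yh))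
      \<le> (transpose (A i) *v (p - xh)) \<bullet> blk_part blk i (y' - yh)" for i
  proof -
    obtain c' where c': "fenchel_conj (blk_space blk i) (g i) (blk_part blk i y') = ereal c'"
      and le: "(transpose (A i) *v p - (1 / \<sigma>) *\<^sub>R (blk_part blk i y' - blk_part blk i y))
          \<bullet> (blk_part blk i yh - blk_part blk i y') \<le> c i - c'"
      by (rule proximal_argmax_subgradient[OF convex_blk_space proper argmax \<open>\<sigma> > 0\<close>
            blk_part_in_blk_space c])
    have "(transpose (A i) *v xh) \<bullet> blk_part blk i (y' - yh)
        = (transpose (A i) *v xh) \<bullet> (blk_part blk i y' - yh)"
      by (simp only: blk_part_diff inner_diff_right
          inner_blk_part[OF transpose_blk_matrix_in_blk_space[OF blocks]])
    moreover have "(transpose (A i) *v xh) \<bullet> (blk_part blk i y' - yh) + c i \<le> c'"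
      using sub[of i "blk_part blk i y'"] unfolding c' by simp
    moreover have "blk_part blk i yh - blk_part blk i y' = - blk_part blk i (y' - yh)"
      "blk_part blk i y' - blk_part blk i y = blk_part blk i (y' - y)"
      by (simp_all add: blk_part_diff)
    moreover note le[unfolded this]
    ultimately show ?thesis
      by (simp add: matrix_vector_mult_diff_distrib inner_diff_left del: transpose_matrix_vector)
  qed
  have "(\<Sum>i\<in>UNIV. (1 / \<sigma>) * (blk_part blk i (y' - y) \<bullet> blk_part blk i (y' - yh)))
      \<le> (\<Sum>i\<in>UNIV. (transpose (A i) *v (p - xh)) \<bullet> blk_part blk i (y' - yh))"
    by (rule sum_mono) (rule block)
  then show ?thesis
    by (simp only: sum_distrib_left[symmetric] sum_inner_blk_part inner_calA[where blk=blk, OF blocks])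
qed

text \<open>
  Since \<open>p = x' + \<tau> *\<^sub>R (B *v (y' - y))\<close>, the dual monotonicity inequality pairs \<open>y - y'\<close> with
  \<open>y' - yh\<close> in the semi-inner product of \<open>G_matrix\<close>. Expanding both squared norms of the old error
  around the new one, the coupling terms between primal and dual errors combine to the nonnegative
  quantity of that inequality (\<open>mono\<close>), which leaves the pairing \<open>d \<bullet> h\<close>. It is bounded
  below by the descent lemma from \<open>x\<close> to \<open>x'\<close>, the tangent inequality from \<open>x\<close> to \<open>xh\<close> and the quadratic support at \<open>xh\<close>.
\<close>

lemma papc_step_descent:
  fixes f :: "real^'n::finite \<Rightarrow> real" and B :: "real^'m::finite^'n"
  assumes conv: "convex_on UNIV f" and deriv: "\<And>x. GDERIV f x :> gradf x"
    and lip: "L-lipschitz_on UNIV gradf"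
    and "\<tau> > 0" and G: "\<And>v. \<tau> * (norm (B *v v))\<^sup>2 \<le> (norm v)\<^sup>2 / \<sigma>"
    and opt: "gradf xh + B *v yh = 0"
    and p: "p = x - \<tau> *\<^sub>R (gradf x + B *v y)"
    and x': "x' = x - \<tau> *\<^sub>R (gradf x + B *v y')"
    and dual: "(1 / \<sigma>) * ((y' - y) \<bullet> (y' - yh)) \<le> (p - xh) \<bullet> (B *v (y' - yh))"
    and supp: "quad_support_at f gradf \<mu> xh x'"
  shows "sqnorm_H \<tau> \<sigma> B ((x', y') - (xh, yh)) + (1 / \<tau> - L) * (norm (x - x'))\<^sup>2
      + \<mu> * (norm (x' - xh))\<^sup>2 \<le> sqnorm_H \<tau> \<sigma> B ((x, y) - (xh, yh))"
proof -
  define d r e s where "d = x' - xh" and "r = x - x'" and "e = y' - yh" and "s = y - y'"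
  define h where "h = gradf x - gradf xh"
  have Bs: "B *v s = B *v y - B *v y'" by (simp add: s_def matrix_vector_mult_diff_distrib)
  have r: "r = \<tau> *\<^sub>R (h + B *v e)"
    using opt by (simp add: r_def x' h_def e_def matrix_vector_mult_diff_distrib algebra_simps
        eq_neg_iff_add_eq_0[symmetric])
  have primal: "(norm (x - xh))\<^sup>2 / \<tau> = (norm d)\<^sup>2 / \<tau> + 2 * (d \<bullet> h + d \<bullet> (B *v e)) + (norm r)\<^sup>2 / \<tau>"
  proof -
    have "x - xh = d + r" by (simp add: d_def r_def)
    then have "(norm (x - xh))\<^sup>2 = (norm d)\<^sup>2 + 2 * (d \<bullet> r) + (norm r)\<^sup>2"
      using norm_add_scaleR_sq[of d 1 r] by simp
    moreover have "d \<bullet> r = \<tau> * (d \<bullet> h + d \<bullet> (B *v e))" by (simp add: r inner_add_right)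
    ultimately show ?thesis using \<open>\<tau> > 0\<close> by (simp add: add_divide_distrib)
  qed
  have dual_sq: "(norm (y - yh))\<^sup>2 / \<sigma> = (norm e)\<^sup>2 / \<sigma> + 2 * ((1 / \<sigma>) * (e \<bullet> s)) + (norm s)\<^sup>2 / \<sigma>"
  proof -
    have "y - yh = e + s" by (simp add: e_def s_def)
    then show ?thesis using norm_add_scaleR_sq[of e 1 s] by (simp add: add_divide_distrib)
  qed
  have image: "(norm (B *v (y - yh)))\<^sup>2 = (norm (B *v e))\<^sup>2 + 2 * ((B *v e) \<bullet> (B *v s)) + (norm (B *v s))\<^sup>2"
  proof -
    have "B *v (y - yh) = B *v e + B *v s"
      by (simp add: e_def s_def matrix_vector_mult_diff_distrib)
    then show ?thesis using norm_add_scaleR_sq[of "B *v e" 1 "B *v s"] by simp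
  qed
  have mono: "0 \<le> (1 / \<sigma>) * (e \<bullet> s) + d \<bullet> (B *v e) - \<tau> * ((B *v e) \<bullet> (B *v s))"
  proof -
    have "p - xh = d - \<tau> *\<^sub>R (B *v s)"
      by (simp add: p d_def x' Bs algebra_simps)
    moreover have "(y' - y) \<bullet> (y' - yh) = - (e \<bullet> s)"
      by (simp add: e_def s_def inner_diff_left inner_diff_right inner_commute)
    ultimately show ?thesis
      using dual by (simp add: e_def[symmetric] inner_diff_left inner_commute[of "B *v s"])
  qed
  have smooth: "\<mu> * (norm d)\<^sup>2 - L * (norm r)\<^sup>2 \<le> 2 * (d \<bullet> h)"
  proof -
    have "f x' \<le> f x + gradf x \<bullet> (x' - x) + L / 2 * (norm (x' - x))\<^sup>2"
      by (rule descent_lemma[OF deriv lip])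
    moreover have "f x + gradf x \<bullet> (xh - x) \<le> f xh"
      by (rule convex_above_tangent[OF conv deriv])
    moreover have "f xh + gradf xh \<bullet> (x' - xh) + \<mu> / 2 * (norm (x' - xh))\<^sup>2 \<le> f x'"
      using supp by (simp add: quad_support_at_def)
    ultimately show ?thesis
      by (simp add: d_def r_def h_def norm_minus_commute[of x' x] inner_diff_left inner_diff_right
          inner_commute algebra_simps)
  qed
  have "sqnorm_H \<tau> \<sigma> B ((x, y) - (xh, yh)) = sqnorm_H \<tau> \<sigma> B (d, e) + 2 * (d \<bullet> h) + (norm r)\<^sup>2 / \<tau>
      + 2 * ((1 / \<sigma>) * (e \<bullet> s) + d \<bullet> (B *v e) - \<tau> * ((B *v e) \<bullet> (B *v s)))
      + ((norm s)\<^sup>2 / \<sigma> - \<tau> * (norm (B *v s))\<^sup>2)"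
    unfolding diff_Pair sqnorm_H_eq primal dual_sq image by (simp add: algebra_simps)
  moreover have "(1 / \<tau> - L) * (norm r)\<^sup>2 = (norm r)\<^sup>2 / \<tau> - L * (norm r)\<^sup>2"
    by (simp add: left_diff_distrib)
  moreover have "0 \<le> (norm s)\<^sup>2 / \<sigma> - \<tau> * (norm (B *v s))\<^sup>2" using G[of s] by simp
  moreover have "h1 + k + m \<le> h2" if "h2 = h1 + a + u + 2 * q + w" "k = u - l" "0 \<le> w" "0 \<le> q" "m - l \<le> a"
    for h1 h2 a u q w k l m :: real
    using that by linarith
  ultimately have "sqnorm_H \<tau> \<sigma> B (d, e) + (1 / \<tau> - L) * (norm r)\<^sup>2 + \<mu> * (norm d)\<^sup>2
      \<le> sqnorm_H \<tau> \<sigma> B ((x, y) - (xh, yh))"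
    using mono smooth by blast
  then show ?thesis by (simp add: d_def e_def r_def)
qed

text \<open>
  Young's inequality with weight \<open>\<alpha> - 1\<close>; this is where the free parameter of the rate enters.
\<close>

lemma norm_diff_sq_young:
  fixes u w :: "'a::real_inner"
  assumes "\<alpha> > 1"
  shows "(norm (u - w))\<^sup>2 \<le> \<alpha> / (\<alpha> - 1) * (norm u)\<^sup>2 + \<alpha> * (norm w)\<^sup>2"
proof -
  define t where "t = \<alpha> - 1"
  have t: "t > 0" "\<alpha> = t + 1" using assms by (simp_all add: t_def)
  have "0 \<le> (norm (u + t *\<^sub>R w))\<^sup>2 / t" using t by simp
  also have "\<dots> = (norm u)\<^sup>2 / t + 2 * (u \<bullet> w) + t * (norm w)\<^sup>2"
    unfolding norm_add_scaleR_sq using t by (simp add: add_divide_distrib)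
  finally have "(norm (u - w))\<^sup>2 \<le> (norm u)\<^sup>2 + (norm w)\<^sup>2 + (norm u)\<^sup>2 / t + t * (norm w)\<^sup>2"
    using norm_add_scaleR_sq[of u "-1" w] by simp
  also have "\<dots> = (t + 1) / t * (norm u)\<^sup>2 + (t + 1) * (norm w)\<^sup>2"
    using t by (simp add: field_simps)
  finally show ?thesis using t by simp
qed

text \<open>
  By optimality of \<open>xh\<close> and the primal update, \<open>B *v (y' - yh)\<close> is the difference of two gradient
  steps, from \<open>x\<close> and from \<open>x'\<close>, divided by \<open>\<tau>\<close>, minus the gradient change from \<open>xh\<close> to \<open>x'\<close>. So
  the dual error is controlled by the two primal quantities that the descent inequality gains.
\<close>

lemma papc_dual_error_bound:
  fixes f :: "real^'n::finite \<Rightarrow> real" and B :: "real^'m::finite^'n"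
  assumes conv: "convex_on UNIV f" and deriv: "\<And>x. GDERIV f x :> gradf x"
    and lip: "L-lipschitz_on UNIV gradf" and "L > 0" and "\<tau> > 0" "\<tau> * L \<le> 2" and "\<alpha> > 1"
    and opt: "gradf xh + B *v yh = 0"
    and x': "x' = x - \<tau> *\<^sub>R (gradf x + B *v y')"
  shows "(norm (B *v (y' - yh)))\<^sup>2
      \<le> \<alpha> / (\<alpha> - 1) * ((norm (x - x'))\<^sup>2 / \<tau>\<^sup>2) + \<alpha> * (L\<^sup>2 * (norm (x' - xh))\<^sup>2)"
proof -
  let ?u = "(1 / \<tau>) *\<^sub>R ((x - \<tau> *\<^sub>R gradf x) - (x' - \<tau> *\<^sub>R gradf x'))"
  let ?w = "gradf x' - gradf xh"
  have "(1 / \<tau>) *\<^sub>R (x - x') = gradf x + B *v y'"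
    using \<open>\<tau> > 0\<close> by (simp add: x')
  moreover have "?u = (1 / \<tau>) *\<^sub>R (x - x') - (gradf x - gradf x')"
    using \<open>\<tau> > 0\<close> by (simp add: algebra_simps)
  moreover have "gradf xh = - (B *v yh)" using opt by (simp add: eq_neg_iff_add_eq_0)
  ultimately have "B *v (y' - yh) = ?u - ?w"
    by (simp add: matrix_vector_mult_diff_distrib)
  then have "(norm (B *v (y' - yh)))\<^sup>2 \<le> \<alpha> / (\<alpha> - 1) * (norm ?u)\<^sup>2 + \<alpha> * (norm ?w)\<^sup>2"
    using norm_diff_sq_young[OF \<open>\<alpha> > 1\<close>, of ?u ?w] by (simp only:)
  also have "\<dots> \<le> \<alpha> / (\<alpha> - 1) * ((norm (x - x'))\<^sup>2 / \<tau>\<^sup>2) + \<alpha> * (L\<^sup>2 * (norm (x' - xh))\<^sup>2)"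
  proof (intro add_mono mult_left_mono)
    have "norm ?u \<le> norm (x - x') / \<tau>"
      using gradient_step_nonexpansive[OF conv deriv lip \<open>L > 0\<close>, of \<tau> x x'] \<open>\<tau> > 0\<close> \<open>\<tau> * L \<le> 2\<close>
      by (simp add: divide_right_mono)
    then have "(norm ?u)\<^sup>2 \<le> (norm (x - x') / \<tau>)\<^sup>2" by (rule power_mono) simp
    then show "(norm ?u)\<^sup>2 \<le> (norm (x - x'))\<^sup>2 / \<tau>\<^sup>2" by (simp only: power_divide)
    have "norm ?w \<le> L * norm (x' - xh)"
      using lipschitz_onD[OF lip, of x' xh] by (simp add: dist_norm)
    then have "(norm ?w)\<^sup>2 \<le> (L * norm (x' - xh))\<^sup>2" by (rule power_mono) simp
    then show "(norm ?w)\<^sup>2 \<le> L\<^sup>2 * (norm (x' - xh))\<^sup>2" by (simp only: power_mult_distrib)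
  qed (use \<open>\<alpha> > 1\<close> in auto)
  finally show ?thesis .
qed

lemma papc_delta_nonneg:
  assumes "0 < \<tau>" "0 < \<sigma>" "\<tau> * L < 1" "0 \<le> lam" "0 < \<mu>" "1 < \<alpha>"
  shows "0 \<le> papc_delta \<tau> \<sigma> L lam \<mu> \<alpha>"
  using assms by (simp add: papc_delta_def)

lemma papc_delta_pos:
  assumes "0 < \<tau>" "0 < \<sigma>" "\<tau> * L < 1" "0 < lam" "0 < \<mu>" "1 < \<alpha>"
  shows "0 < papc_delta \<tau> \<sigma> L lam \<mu> \<alpha>"
  using assms by (simp add: papc_delta_def add_nonneg_pos)

text \<open>
  The descent inequality gains \<open>(1 / \<tau> - L) * R + \<mu> * X\<close>. The error bound shows that the new squared
  error is at most a combination of \<open>R\<close> and \<open>X\<close>; the two terms of \<open>papc_delta\<close> are the largest factors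
  for which the coefficients of \<open>R\<close> and of \<open>X\<close> stay below those gained.
\<close>

lemma papc_step_contraction:
  fixes f :: "real^'n::finite \<Rightarrow> real" and B :: "real^'m::finite^'n"
  assumes conv: "convex_on UNIV f" and deriv: "\<And>x. GDERIV f x :> gradf x"
    and lip: "L-lipschitz_on UNIV gradf"
    and L: "L > 0" and \<tau>: "\<tau> > 0" "\<tau> * L < 1" and \<sigma>: "\<sigma> > 0"
    and G: "\<And>v. \<tau> * (norm (B *v v))\<^sup>2 \<le> (norm v)\<^sup>2 / \<sigma>"
    and opt: "gradf xh + B *v yh = 0"
    and p: "p = x - \<tau> *\<^sub>R (gradf x + B *v y)"
    and x': "x' = x - \<tau> *\<^sub>R (gradf x + B *v y')"
    and dual: "(1 / \<sigma>) * ((y' - y) \<bullet> (y' - yh)) \<le> (p - xh) \<bullet> (B *v (y' - yh))"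
    and supp: "quad_support_at f gradf \<mu> xh x'" and \<mu>: "\<mu> > 0" and \<alpha>: "\<alpha> > 1"
  shows "sqnorm_H \<tau> \<sigma> B ((x', y') - (xh, yh))
      \<le> 1 / (1 + papc_delta \<tau> \<sigma> L (lambda_min (transpose B ** B)) \<mu> \<alpha>)
          * sqnorm_H \<tau> \<sigma> B ((x, y) - (xh, yh))"
proof -
  define lam where "lam = lambda_min (transpose B ** B)"
  define \<delta> where "\<delta> = papc_delta \<tau> \<sigma> L lam \<mu> \<alpha>"
  define X R where "X = (norm (x' - xh))\<^sup>2" and "R = (norm (x - x'))\<^sup>2"
  have "X \<ge> 0" "R \<ge> 0" by (simp_all add: X_def R_def)
  have lam: "lam \<ge> 0" unfolding lam_def by (rule lambda_min_gram_nonneg)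
  have \<delta>: "\<delta> \<ge> 0" unfolding \<delta>_def by (rule papc_delta_nonneg) (use \<tau> \<sigma> lam \<mu> \<alpha> in auto)
  have descent: "sqnorm_H \<tau> \<sigma> B ((x', y') - (xh, yh)) + ((1 / \<tau> - L) * R + \<mu> * X)
      \<le> sqnorm_H \<tau> \<sigma> B ((x, y) - (xh, yh))"
    using papc_step_descent[OF conv deriv lip \<tau>(1) G opt p x' dual supp] by (simp add: X_def R_def)
  have "\<delta> * sqnorm_H \<tau> \<sigma> B ((x', y') - (xh, yh)) \<le> (1 / \<tau> - L) * R + \<mu> * X"
  proof (cases "lam = 0")
    case True
    \<comment> \<open>Without full rank of the coupling the rate is trivial and only monotonicity remains.\<close>
    then have "\<delta> = 0" by (simp add: \<delta>_def papc_delta_def)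
    moreover have "1 / \<tau> - L \<ge> 0" using \<tau> by (simp add: field_simps)
    ultimately show ?thesis using \<mu> \<open>X \<ge> 0\<close> \<open>R \<ge> 0\<close> by simp
  next
    case False
    with lam have lam: "lam > 0" by simp
    define E where "E = (norm (y' - yh))\<^sup>2"
    have "lam * E \<le> (norm (B *v (y' - yh)))\<^sup>2"
      unfolding lam_def E_def by (rule lambda_min_gram_le)
    also have "\<dots> \<le> \<alpha> / (\<alpha> - 1) * (R / \<tau>\<^sup>2) + \<alpha> * (L\<^sup>2 * X)"
      unfolding R_def X_def
      by (rule papc_dual_error_bound[OF conv deriv lip L \<tau>(1) _ \<alpha> opt x']) (use \<tau> in simp)
    finally have E: "E \<le> (\<alpha> / (\<alpha> - 1) * (R / \<tau>\<^sup>2) + \<alpha> * (L\<^sup>2 * X)) / lam"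
      using lam by (simp add: pos_le_divide_eq mult.commute)
    have "sqnorm_H \<tau> \<sigma> B ((x', y') - (xh, yh)) \<le> X / \<tau> + E / \<sigma>"
      using \<tau>(1) by (simp add: sqnorm_H_eq X_def E_def)
    also have "\<dots> \<le> X / \<tau> + (\<alpha> / (\<alpha> - 1) * (R / \<tau>\<^sup>2) + \<alpha> * (L\<^sup>2 * X)) / lam / \<sigma>"
      using divide_right_mono[OF E, of \<sigma>] \<sigma> by simp
    also have "\<dots> = \<alpha> / ((\<alpha> - 1) * \<tau>\<^sup>2 * \<sigma> * lam) * R
        + ((\<alpha> * \<tau> * L\<^sup>2 + \<sigma> * lam) / (\<tau> * \<sigma> * lam)) * X"
      using \<tau>(1) \<sigma> lam \<alpha> by (simp add: field_simps)
    finally have "\<delta> * sqnorm_H \<tau> \<sigma> B ((x', y') - (xh, yh))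
        \<le> \<delta> * (\<alpha> / ((\<alpha> - 1) * \<tau>\<^sup>2 * \<sigma> * lam) * R
        + ((\<alpha> * \<tau> * L\<^sup>2 + \<sigma> * lam) / (\<tau> * \<sigma> * lam)) * X)"
      using \<delta> by (rule mult_left_mono)
    also have "\<dots> = (\<delta> * (\<alpha> / ((\<alpha> - 1) * \<tau>\<^sup>2 * \<sigma> * lam))) * R
        + (\<delta> * ((\<alpha> * \<tau> * L\<^sup>2 + \<sigma> * lam) / (\<tau> * \<sigma> * lam))) * X"
      by (simp only: distrib_left mult.assoc)
    also have "\<dots> \<le> (1 / \<tau> - L) * R + \<mu> * X"
    proof (intro add_mono mult_right_mono)
      have "\<delta> \<le> (\<alpha> - 1) * \<tau> * \<sigma> * (1 - \<tau> * L) * lam / \<alpha>" by (simp add: \<delta>_def papc_delta_def)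
      then have "\<delta> * (\<alpha> / ((\<alpha> - 1) * \<tau>\<^sup>2 * \<sigma> * lam))
          \<le> (\<alpha> - 1) * \<tau> * \<sigma> * (1 - \<tau> * L) * lam / \<alpha> * (\<alpha> / ((\<alpha> - 1) * \<tau>\<^sup>2 * \<sigma> * lam))"
        by (rule mult_right_mono) (use \<tau> \<sigma> lam \<alpha> in simp)
      also have "\<dots> = (1 - \<tau> * L) / \<tau>" 
        using \<tau>(1) \<sigma> lam \<alpha> by (simp add: power2_eq_square)
      also have "\<dots> = 1 / \<tau> - L" using \<tau>(1) by (simp add: diff_divide_distrib)
      finally show "\<delta> * (\<alpha> / ((\<alpha> - 1) * \<tau>\<^sup>2 * \<sigma> * lam)) \<le> 1 / \<tau> - L" .
      have D: "\<alpha> * \<tau> * L\<^sup>2 + \<sigma> * lam > 0" using \<tau> \<sigma> lam \<alpha> by (intro add_nonneg_pos) auto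
      have "\<delta> \<le> \<mu> * \<tau> * \<sigma> * lam / (\<alpha> * \<tau> * L\<^sup>2 + \<sigma> * lam)" by (simp add: \<delta>_def papc_delta_def)
      then have "\<delta> * ((\<alpha> * \<tau> * L\<^sup>2 + \<sigma> * lam) / (\<tau> * \<sigma> * lam))
          \<le> \<mu> * \<tau> * \<sigma> * lam / (\<alpha> * \<tau> * L\<^sup>2 + \<sigma> * lam)
            * ((\<alpha> * \<tau> * L\<^sup>2 + \<sigma> * lam) / (\<tau> * \<sigma> * lam))"
        by (rule mult_right_mono) (use \<tau> \<sigma> lam D in simp)
      also have "\<dots> = \<mu>" using D \<tau>(1) \<sigma> lam by simp
      finally show "\<delta> * ((\<alpha> * \<tau> * L\<^sup>2 + \<sigma> * lam) / (\<tau> * \<sigma> * lam)) \<le> \<mu>" .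
    qed (use \<open>X \<ge> 0\<close> \<open>R \<ge> 0\<close> in auto)
    finally show ?thesis .
  qed
  with descent have "(1 + \<delta>) * sqnorm_H \<tau> \<sigma> B ((x', y') - (xh, yh)) \<le> sqnorm_H \<tau> \<sigma> B ((x, y) - (xh, yh))"
    by (simp add: distrib_right)
  then have "sqnorm_H \<tau> \<sigma> B ((x', y') - (xh, yh)) \<le> sqnorm_H \<tau> \<sigma> B ((x, y) - (xh, yh)) / (1 + \<delta>)"
    using \<delta> by (simp add: pos_le_divide_eq mult.commute)
  then show ?thesis by (simp add: \<delta>_def lam_def)
qed

section \<open>Linear convergence\<close>

lemma norm_sq_le_sqnorm_H:
  fixes B :: "real^'m::finite^'n::finite"
  assumes "\<tau> > 0" and G: "\<And>v. \<tau> * (norm (B *v v))\<^sup>2 \<le> (norm v)\<^sup>2 / \<sigma>"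
  shows "(norm x)\<^sup>2 \<le> \<tau> * sqnorm_H \<tau> \<sigma> B (x, y)"
proof -
  have "(norm x)\<^sup>2 / \<tau> \<le> sqnorm_H \<tau> \<sigma> B (x, y)" using G[of y] by (simp add: sqnorm_H_eq)
  then show ?thesis using \<open>\<tau> > 0\<close> by (simp add: pos_divide_le_eq mult.commute)
qed

text \<open>
  The seminorm given by \<open>G_matrix\<close> may vanish on nonzero dual vectors, so convergence of the dual
  iterates is derived from that of their images under the coupling matrix.
\<close>

lemma full_rank_tendsto:
  fixes B :: "real^'m::finite^'n::finite"
  assumes rank: "lambda_min (transpose B ** B) > 0" and lim: "((\<lambda>k. B *v y k) \<longlongrightarrow> B *v yh) F"
  shows "(y \<longlongrightarrow> yh) F"
proof -
  let ?l = "lambda_min (transpose B ** B)"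
  have "((\<lambda>k. sqrt (1 / ?l) * norm (B *v y k - B *v yh)) \<longlongrightarrow> sqrt (1 / ?l) * norm (B *v yh - B *v yh)) F"
    by (intro tendsto_intros lim)
  then have lim0: "((\<lambda>k. sqrt (1 / ?l) * norm (B *v y k - B *v yh)) \<longlongrightarrow> 0) F" by simp
  have "norm (y k - yh) \<le> sqrt (1 / ?l) * norm (B *v y k - B *v yh)" for k
  proof (rule power2_le_imp_le)
    have "?l * (norm (y k - yh))\<^sup>2 \<le> (norm (B *v (y k - yh)))\<^sup>2" by (rule lambda_min_gram_le)
    then show "(norm (y k - yh))\<^sup>2 \<le> (sqrt (1 / ?l) * norm (B *v y k - B *v yh))\<^sup>2"
      using rank by (simp add: power_mult_distrib real_sqrt_pow2 matrix_vector_mult_diff_distrib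
          pos_le_divide_eq mult.commute)
  qed (use rank in simp)
  then have "((\<lambda>k. y k - yh) \<longlongrightarrow> 0) F"
    by (intro Lim_null_comparison[OF _ lim0] always_eventually allI)
  then show ?thesis by (rule Lim_null[THEN iffD2])
qed

theorem theorem3p1:
  fixes f :: "real^'n::finite \<Rightarrow> real"
    and gradf :: "real^'n \<Rightarrow> real^'n"
    and blk :: "'m::finite \<Rightarrow> 'p::finite"
    and g :: "'p \<Rightarrow> real^'m \<Rightarrow> ereal"
    and A :: "'p \<Rightarrow> real^'m^'n"
    and L \<tau> \<sigma> :: real
    and xh :: "real^'n" and yh :: "real^'m"
  assumes blocks: "surj blk" "\<And>i. blk_matrix blk i (A i)"
    and f_convex: "convex_on UNIV f"
    and f_C1: "\<And>x. GDERIV f x :> gradf x" "continuous_on UNIV gradf"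
    and f_Lipschitz: "L-lipschitz_on UNIV gradf"
    and g_proper: "\<And>i. proper_on (blk_space blk i) (g i)"
    and g_lsc: "\<And>i. lsc_on (blk_space blk i) (g i)"
    and g_convex: "\<And>i. ereal_convex_on (blk_space blk i) (g i)"
    and A_full_rank: "\<And>i. lambda_min_on (blk_space blk i) (transpose (A i) ** A i) > 0"
    and solvable: "primal_solutions f g A \<noteq> {}"
    and quad_supp: "\<And>x. x \<in> primal_solutions f g A \<Longrightarrow> pointwise_quad_supportable f gradf x"
    and tau: "0 < \<tau>" "\<tau> < 1 / L"
    and sigma: "0 < \<tau> * \<sigma>"
      "\<tau> * \<sigma> \<le> 1 / onorm (\<lambda>y. (transpose (calA A) ** calA A) *v y)"
    and saddle: "saddle_point (lagrangian f blk g A) (xh, yh)"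
  shows
    "\<exists>M :: real \<Rightarrow> real. (\<forall>r. M r > 0) \<and>
      (\<forall>p x y. papc gradf blk g A \<tau> \<sigma> p x y \<longrightarrow>
        (\<forall>k. quad_support_at f gradf
                (M (norm_H \<tau> \<sigma> (calA A) ((x 0, y 0) - (xh, yh)))) xh (x k)) \<and>
        (\<forall>\<mu> \<alpha>. \<mu> > 0 \<and> (\<forall>k\<ge>1. quad_support_at f gradf \<mu> xh (x k)) \<and> \<alpha> > 1 \<longrightarrow>
          (let \<delta> = papc_delta \<tau> \<sigma> L (lambda_min (transpose (calA A) ** calA A)) \<mu> \<alpha>
           in (coupling_full_rank A \<longrightarrow> \<delta> > 0) \<and>
              (\<forall>k\<ge>1. sqnorm_H \<tau> \<sigma> (calA A) ((x k, y k) - (xh, yh))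
                 \<le> 1 / (1 + \<delta>) *
                   sqnorm_H \<tau> \<sigma> (calA A) ((x (k - 1), y (k - 1)) - (xh, yh))))) \<and>
        (coupling_full_rank A \<longrightarrow>
          (\<exists>us. saddle_point (lagrangian f blk g A) us \<and>
                Q_linear (norm_H \<tau> \<sigma> (calA A)) (\<lambda>k. (x k, y k)) us)))"
proof -
  define B where "B = calA A"
  define lam where "lam = lambda_min (transpose B ** B)"
  have "\<sigma> > 0" using sigma(1) tau(1) by (simp add: zero_less_mult_iff)
  have "L \<ge> 0" using f_Lipschitz by (rule lipschitz_on_nonneg)
  \<comment> \<open>For \<open>L = 0\<close> the bound on \<open>\<tau>\<close> would read \<open>\<tau> < 0\<close>, as \<open>1 / 0 = 0\<close>.\<close>
  moreover have "L \<noteq> 0" using tau by auto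
  ultimately have "L > 0" by simp
  then have tau_L: "\<tau> * L < 1" using tau by (simp add: pos_less_divide_eq)
  have G: "\<tau> * (norm (B *v v))\<^sup>2 \<le> (norm v)\<^sup>2 / \<sigma>" for v
    using step_size_bound[OF sigma, of v] \<open>\<sigma> > 0\<close> by (simp add: B_def field_simps)

  obtain c where c: "\<And>i. fenchel_conj (blk_space blk i) (g i) (blk_part blk i yh) = ereal (c i)"
    and sub: "\<And>i v. ereal ((transpose (A i) *v xh) \<bullet> (v - yh) + c i)
      \<le> fenchel_conj (blk_space blk i) (g i) v"
    and "\<And>x. f xh + xh \<bullet> (calA A *v yh) \<le> f x + x \<bullet> (calA A *v yh)"
    using saddle_point_optimality[OF blocks(2) g_proper g_lsc g_convex saddle] by blast
  then have opt: "gradf xh + B *v yh = 0"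
    unfolding B_def by (intro saddle_point_gradient[OF f_C1(1)])
  have "pointwise_quad_supportable f gradf xh"
    by (intro quad_supp saddle_point_imp_primal_solution[OF blocks(2) g_proper g_lsc g_convex saddle])
  then obtain M where M_pos: "\<And>r. (M r :: real) > 0"
    and M: "\<And>r x. norm (x - xh) \<le> r \<Longrightarrow> quad_support_at f gradf (M r) xh x"
    using quad_support_on_balls[OF f_convex] by blast

  \<comment> \<open>By \<open>x_norm\<close> below, an error of \<open>r\<close> in the \<open>H\<close>-norm keeps \<open>x\<close> within \<open>sqrt \<tau> * r\<close> of \<open>xh\<close>.\<close>
  define M' where "M' r = M (sqrt \<tau> * r)" for r
  have main: "(\<forall>k. quad_support_at f gradf (M' (norm_H \<tau> \<sigma> B ((x 0, y 0) - (xh, yh)))) xh (x k)) \<and>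
        (\<forall>\<mu> \<alpha>. \<mu> > 0 \<and> (\<forall>k\<ge>1. quad_support_at f gradf \<mu> xh (x k)) \<and> \<alpha> > 1 \<longrightarrow>
          (let \<delta> = papc_delta \<tau> \<sigma> L lam \<mu> \<alpha>
           in (coupling_full_rank A \<longrightarrow> \<delta> > 0) \<and>
              (\<forall>k\<ge>1. sqnorm_H \<tau> \<sigma> B ((x k, y k) - (xh, yh))
                 \<le> 1 / (1 + \<delta>) * sqnorm_H \<tau> \<sigma> B ((x (k - 1), y (k - 1)) - (xh, yh))))) \<and>
        (coupling_full_rank A \<longrightarrow> Q_linear (norm_H \<tau> \<sigma> B) (\<lambda>k. (x k, y k)) (xh, yh))"
    if papc: "papc gradf blk g A \<tau> \<sigma> p x y" for p x y
  proof -
    define S where "S k = sqnorm_H \<tau> \<sigma> B ((x k, y k) - (xh, yh))" for k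
    have p: "p (Suc k) = x k - \<tau> *\<^sub>R (gradf (x k) + B *v y k)"
      and x: "x (Suc k) = x k - \<tau> *\<^sub>R (gradf (x k) + B *v y (Suc k))" for k
      using papc by (simp_all add: papc_def B_def)
    have dual: "(1 / \<sigma>) * ((y (Suc k) - y k) \<bullet> (y (Suc k) - yh))
        \<le> (p (Suc k) - xh) \<bullet> (B *v (y (Suc k) - yh))" for k
      unfolding B_def
    proof (rule papc_dual_monotone[OF blocks(2) g_proper c sub \<open>\<sigma> > 0\<close>])
      have "1 \<le> Suc k" by simp
      with papc[unfolded papc_def, rule_format, OF this]
      show "is_arg_max
             (\<lambda>v. ereal ((transpose (A i) *v p (Suc k)) \<bullet> v)
                   - fenchel_conj (blk_space blk i) (g i) v
                   - ereal (1 / (2 * \<sigma>) * (norm (v - blk_part blk i (y k)))\<^sup>2))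
             (\<lambda>v. v \<in> blk_space blk i)
             (blk_part blk i (y (Suc k)))" for i
        unfolding diff_Suc_1 by blast
    qed
    \<comment> \<open>Convexity is quadratic support with constant \<open>0\<close>, so the error never increases. This confines
    the iterates to a ball before any positive support constant is known.\<close>
    have "S (Suc k) \<le> S k" for k
    proof -
      have "quad_support_at f gradf 0 xh (x (Suc k))"
        using convex_above_tangent[OF f_convex f_C1(1)[of xh], of "x (Suc k)"]
        by (simp add: quad_support_at_def)
      from papc_step_descent[OF f_convex f_C1(1) f_Lipschitz tau(1) G opt p x dual this]
      have "S (Suc k) + (1 / \<tau> - L) * (norm (x k - x (Suc k)))\<^sup>2 \<le> S k" by (simp add: S_def)
      moreover have "1 / \<tau> - L \<ge> 0" using tau(1) tau_L by (simp add: field_simps)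
      then have "0 \<le> (1 / \<tau> - L) * (norm (x k - x (Suc k)))\<^sup>2" by simp
      ultimately show ?thesis by linarith
    qed
    then have S_le: "S k \<le> S 0" for k using lift_Suc_antimono_le[of S 0 k] by simp
    have x_S: "(norm (x k - xh))\<^sup>2 \<le> \<tau> * S k" for k
      using norm_sq_le_sqnorm_H[OF tau(1) G] by (simp add: S_def)
    have x_norm: "norm (x k - xh) \<le> sqrt \<tau> * sqrt (S k)" for k
      using real_sqrt_le_mono[OF x_S[of k]] by (simp add: real_sqrt_mult)
    have norm_H: "norm_H \<tau> \<sigma> B ((x k, y k) - (xh, yh)) = sqrt (S k)" for k
      by (simp only: norm_H_def S_def)
    have supp: "quad_support_at f gradf (M' (sqrt (S 0))) xh (x k)" for k
    proof -
      have "sqrt \<tau> * sqrt (S k) \<le> sqrt \<tau> * sqrt (S 0)"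
        by (intro mult_left_mono real_sqrt_le_mono S_le) (use tau(1) in simp)
      with x_norm[of k] have "norm (x k - xh) \<le> sqrt \<tau> * sqrt (S 0)" by linarith
      then show ?thesis unfolding M'_def by (rule M)
    qed
    have contraction: "S (Suc k) \<le> 1 / (1 + papc_delta \<tau> \<sigma> L lam \<mu> \<alpha>) * S k"
      if "\<mu> > 0" "\<alpha> > 1" "quad_support_at f gradf \<mu> xh (x (Suc k))" for \<mu> \<alpha> k
      unfolding S_def lam_def
      by (rule papc_step_contraction[OF f_convex f_C1(1) f_Lipschitz \<open>L > 0\<close> tau(1) tau_L
            \<open>\<sigma> > 0\<close> G opt p x dual that(3,1,2)])
    have delta_pos: "papc_delta \<tau> \<sigma> L lam \<mu> \<alpha> > 0" if "\<mu> > 0" "\<alpha> > 1" "coupling_full_rank A" for \<mu> \<alpha>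
      using that tau(1) \<open>\<sigma> > 0\<close> tau_L
      by (intro papc_delta_pos) (simp_all add: coupling_full_rank_def lam_def B_def)
    have "Q_linear (norm_H \<tau> \<sigma> B) (\<lambda>k. (x k, y k)) (xh, yh)" if rank: "coupling_full_rank A"
    proof -
      define \<delta> where "\<delta> = papc_delta \<tau> \<sigma> L lam (M' (sqrt (S 0))) 2"
      define q where "q = sqrt (1 / (1 + \<delta>))"
      have "\<delta> > 0" unfolding \<delta>_def using rank by (intro delta_pos) (simp_all add: M'_def M_pos)
      then have q: "0 < q" "q < 1" by (simp_all add: q_def)
      have lin: "sqrt (S (Suc k)) \<le> q * sqrt (S k)" for k
      proof -
        have "S (Suc k) \<le> 1 / (1 + \<delta>) * S k"
          unfolding \<delta>_def by (rule contraction) (simp_all add: M'_def M_pos supp[unfolded M'_def])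
        from real_sqrt_le_mono[OF this] show ?thesis by (simp only: real_sqrt_mult q_def)
      qed
      have S_nonneg: "0 \<le> S k" for k
        using x_S[of k] tau(1) by (smt (verit) zero_le_power2 zero_le_mult_iff)
      have "summable (\<lambda>k. sqrt (S k))"
        by (rule summable_ratio_test[where c = q and N = 0]) (use q lin S_nonneg in auto)
      then have "(\<lambda>k. sqrt (S k)) \<longlonglongrightarrow> 0" by (rule summable_LIMSEQ_zero)
      then have "(\<lambda>k. sqrt \<tau> * sqrt (S k)) \<longlonglongrightarrow> 0" by (rule tendsto_mult_right_zero)
      then have "(\<lambda>k. x k - xh) \<longlonglongrightarrow> 0"
        by (rule Lim_null_comparison[rotated]) (simp add: x_norm)
      then have x_lim: "x \<longlonglongrightarrow> xh" by (rule Lim_null[THEN iffD2])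
      \<comment> \<open>The primal update expresses \<open>B *v y (Suc k)\<close> through the primal iterates, which converge.\<close>
      have "(\<lambda>k. gradf (x k)) \<longlonglongrightarrow> gradf xh"
        by (rule continuous_on_tendsto_compose[OF f_C1(2) x_lim]) auto
      then have "(\<lambda>k. (1 / \<tau>) *\<^sub>R (x k - x (Suc k)) - gradf (x k)) \<longlonglongrightarrow> (1 / \<tau>) *\<^sub>R (xh - xh) - gradf xh"
        by (intro tendsto_intros x_lim LIMSEQ_Suc[OF x_lim])
      moreover have "(1 / \<tau>) *\<^sub>R (x k - x (Suc k)) - gradf (x k) = B *v y (Suc k)" for k
        using tau(1) by (simp add: x)
      moreover have "- gradf xh = B *v yh" using opt by (simp add: minus_unique)
      ultimately have "(\<lambda>k. B *v y (Suc k)) \<longlonglongrightarrow> B *v yh" by simp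
      then have "(\<lambda>k. y (Suc k)) \<longlonglongrightarrow> yh"
        by (rule full_rank_tendsto[rotated]) (use rank in \<open>simp add: coupling_full_rank_def B_def\<close>)
      then have "y \<longlonglongrightarrow> yh" by (rule LIMSEQ_imp_Suc)
      with x_lim have "(\<lambda>k. (x k, y k)) \<longlonglongrightarrow> (xh, yh)" by (rule tendsto_Pair)
      with q lin show ?thesis unfolding Q_linear_def norm_H by blast
    qed
    moreover have "\<forall>k\<ge>1. S k \<le> 1 / (1 + papc_delta \<tau> \<sigma> L lam \<mu> \<alpha>) * S (k - 1)"
      if "\<mu> > 0" "\<alpha> > 1" "\<forall>k\<ge>1. quad_support_at f gradf \<mu> xh (x k)" for \<mu> \<alpha>
    proof (intro allI impI)
      fix k :: nat assume "1 \<le> k"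
      then obtain j where "k = Suc j" by (cases k) auto
      with contraction[OF that(1,2), of j] that(3)
      show "S k \<le> 1 / (1 + papc_delta \<tau> \<sigma> L lam \<mu> \<alpha>) * S (k - 1)" by simp
    qed
    ultimately show ?thesis
      unfolding norm_H S_def[symmetric] Let_def using supp delta_pos by blast
  qed
  show ?thesis
  proof (intro exI[of _ M'] conjI allI impI)
    show "M' r > 0" for r by (simp add: M'_def M_pos)
  qed (use main saddle in \<open>unfold B_def lam_def, blast+\<close>)
qed

end
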